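(* Consider the FSIPL algorithm described in the context, and assume that its parameter $\alpha$ satisfies $$\alpha>\max\Big\{\frac{M_1}{C_1},\ M_2+\frac{\sigma\hat\tau^2}{2}\Big\},\qquad M_1:=\sqrt{C_2}(\ell_f+\ell_g\ell_{\mathcal A}),\quad M_2:=\kappa(\ell_f+\ell_g\ell_{\mathcal A}),\quad \hat\tau:=\min\Big\{\frac{2\kappa C_1}{\theta L_hC_2},\frac1{C_2}\Big\},$$ and that $\{\Delta_k\}_{k\in\mathbb N}$ is summable. Let $\{x^k\}_{k\in\mathbb N}$ be the sequence generated by the algorithm, and for $\varepsilon>0$ let $$T(\varepsilon):=\min\{k: x^k\text{ is an }\varepsilon\text{-stationary point of }\min_{x\in\mathcal M}F(x)\}.$$ Then there exist $U>0$ and $V>0$ (independent of $\varepsilon$) such that for every $\varepsilon>0$, $$T(\varepsilon)\le\max\Big\{\frac{UV^2}{\varepsilon^2},\ \frac{UV}{\varepsilon}\Big\}.$$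
   Context: Notation. $\|\cdot\|$ is the Euclidean norm (spectral norm for matrices). For a smooth map $\psi:\mathbb R^n\to\mathbb R^m$ with $m$ components, $\nabla\psi(x)\in\mathbb R^{m\times n}$ is its Jacobian; for real-valued $f$, $\nabla f(x)\in\mathbb R^n$ is the gradient. For closed convex $g$ and $t>0$: $M_g^t(x):=\min_y\{g(y)+\frac1{2t}\|y-x\|^2\}$ and $\mathrm{prox}_{tg}(x)$ is the unique minimizer. $\partial g$ is the convex subdifferential. $\mathcal S$ is the set of nonnegative summable real sequences. Problem. $\mathcal M\subseteq\mathbb R^n$ is a compact embedded submanifold, $\mathcal M_a:=\{x:\mathrm{dist}(x,\mathcal M)\le a\}$, and the problem is $\min_{x\in\mathcal M}F(x):=f(x)+g(\mathcal A(x))$, where $f:\mathbb R^n\to\mathbb R$ and $\mathcal A:\mathbb R^n\to\mathbb R^p$ are continuously differentiable and $g:\mathbb R^p\to\mathbb R$ is closed and convex. Standing assumptions: (i) $\mathcal M=\{x:h(x)=0\}$ for some $h:\mathbb R^n\to\mathbb R^m$, and there is $\kappa>0$ with $\mathrm{dist}(x,\mathcal M)\le\kappa\|h(x)\|$ for all $x\in\mathbb R^n$; (ii) $\nabla h$ is $L_h$-Lipschitz on $\mathbb R^n$, and there are $\theta>0$, $0<C_1\le C_2$ such that for all $x\in\mathcal M_{2\theta}$ the eigenvalues of $\nabla h(x)\nabla h(x)^\top$ lie in $[C_1,C_2]$; (iii) $\nabla f$ is $L_f$-Lipschitz on $\mathbb R^n$; (iv) $g$ is $\ell_g$-Lipschitz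 on $\mathbb R^p$; (v) $\nabla\mathcal A$ is $L_{\mathcal A}$-Lipschitz on $\mathbb R^n$. Constants $\ell_f,\ell_{\mathcal A}>0$ are fixed with $\|\nabla f(x)\|\le\ell_f$ and $\|\nabla\mathcal A(x)\|\le\ell_{\mathcal A}$ for all $x\in\mathcal M_{2\theta}$. $L_h>0$. $\varepsilon$-stationarity. $x\in\mathbb R^n$ is an $\varepsilon$-stationary point if there exist $v\in\mathbb R^p$, $\lambda\in\mathbb R^m$ with $\max\{\mathrm{dist}(0,\nabla f(x)+\nabla\mathcal A(x)^\top\partial g(\mathcal A(x)+v)+\nabla h(x)^\top\lambda),\ \|v\|,\ \|h(x)\|\}<\varepsilon.$ FSIPL algorithm. Inputs: $x^0\in\mathcal M$, $\gamma\in(0,1)$, $\alpha>0$, positive numbers $\underline t\le\overline t$, $\overline\Delta,\overline\eta,\overline\tau,\sigma$, the constants $\theta,\kappa$ above, and $\{\rho_k\}\in\mathcal S$. Put $N(x):=\frac12\|h(x)\|^2$ (so $\nabla N(x)=\nabla h(x)^\top h(x)$) and $\Phi_\alpha(x):=F(x)+\alpha\|h(x)\|$. For $k=0,1,2,\dots$: 1. Choose $t_k\in[\underline t,\overline t]$, $\Delta_k\in[0,\overline\Delta]$. 2. Find $(\lambda^k,\mu^k)\in\mathbb R^m\times\mathbb R^p$ with $\|\nabla G_k(\lambda^k,\mu^k)\|\le\Delta_k$, where $G_k(\lambda,\mu):=\frac{t_k}2\|\nabla f(x^k)+\nabla h(x^k)^\top\lambda+\nabla\mathcal A(x^k)^\top\mu\|^2+\frac{t_k}2\|\mu\|^2-M_g^{t_k}(\mathcal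 A(x^k)+t_k\mu)$ (a convex $C^1$ function). 3. Set $d^k:=-t_k(\nabla f(x^k)+\nabla h(x^k)^\top\lambda^k+\nabla\mathcal A(x^k)^\top\mu^k)$ and $v^k:=\mathrm{prox}_{t_kg}(\mathcal A(x^k)+t_k\mu^k)-\mathcal A(x^k)$. 4. Set $\eta_k\leftarrow\overline\eta$, $\tau_k\leftarrow\overline\tau$. 5. (Inner loop) Set $y^k:=x^k+\eta_kd^k$, and $\hat x^{k+1}:=y^k-\tau_k\nabla N(y^k)$ if $\|h(y^k)\|\le\theta/\kappa$, otherwise $\hat x^{k+1}:=$ a nearest point of $\mathcal M$ to $y^k$. If $\|h(\hat x^{k+1})\|\le\theta/\kappa$ and $\Phi_\alpha(\hat x^{k+1})\le\Phi_\alpha(x^k)-\frac\sigma2(\eta_k^2\|d^k\|^2+\tau_k^2\|h(y^k)\|)-\frac{\eta_k}{2t_k}\|v^k\|^2+\eta_k(\alpha+\ell_g+\|\lambda^k\|+\|\mu^k\|)\Delta_k+\rho_k$, accept: $x^{k+1}\leftarrow\hat x^{k+1}$ and go to the next $k$. Otherwise reject: $\eta_k\leftarrow\gamma\eta_k$, $\tau_k\leftarrow\frac\gamma2\tau_k$, and repeat step 5. *)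

theory Defs
  imports "HOL-Analysis.Analysis"
begin

definition gradient :: "('a::real_inner \<Rightarrow> real) \<Rightarrow> 'a \<Rightarrow> 'a" where
  "gradient f x = (THE D. GDERIV f x :> D)"

definition C1_on :: "'a::real_normed_vector set \<Rightarrow> ('a \<Rightarrow> 'b::real_normed_vector) \<Rightarrow> bool" where
  "C1_on S f \<longleftrightarrow>
     (\<exists>f' :: 'a \<Rightarrow> 'a \<Rightarrow>\<^sub>L 'b.
        (\<forall>x\<in>S. (f has_derivative blinfun_apply (f' x)) (at x)) \<and> continuous_on S f')"

text \<open>The type class norm of a matrix is its Frobenius norm, so the spectral norm is
  defined separately, as the operator norm for the Euclidean norms.\<close>

definition spectral_norm :: "real^'n^'m \<Rightarrow> real" where
  "spectral_norm A = onorm (\<lambda>v. A *v v)"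

text \<open>Only real eigenvalues are considered; the definition is used for symmetric matrices.\<close>

definition eigenvalues :: "real^'n^'n \<Rightarrow> real set" where
  "eigenvalues A = {e. \<exists>v. v \<noteq> 0 \<and> A *v v = e *\<^sub>R v}"

text \<open>Embedded submanifold in the sense of slice charts of class \<open>C\<^sup>1\<close>.  No higher
  smoothness is required, because the defining map is only of class \<open>C\<^sup>1\<close>
  with Lipschitz continuous Jacobian.\<close>

definition embedded_submanifold :: "'a::euclidean_space set \<Rightarrow> bool" where
  "embedded_submanifold S \<longleftrightarrow>
     (\<exists>d. \<forall>x\<in>S. \<exists>U V (\<phi> :: 'a \<Rightarrow> 'a) \<psi> L.
        open U \<and> x \<in> U \<and> open V \<and> homeomorphism U V \<phi> \<psi> \<and> C1_on U \<phi> \<and> C1_on V \<psi> \<and>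
        subspace L \<and> dim L = d \<and> \<phi> ` (S \<inter> U) = V \<inter> L)"

definition tube :: "'a::metric_space set \<Rightarrow> real \<Rightarrow> 'a set" where
  "tube M a = {x. infdist x M \<le> a}"

definition subdifferential :: "('a::real_inner \<Rightarrow> real) \<Rightarrow> 'a \<Rightarrow> 'a set" where
  "subdifferential g x = {w. \<forall>y. g y \<ge> g x + w \<bullet> (y - x)}"

definition moreau_env :: "('a::real_normed_vector \<Rightarrow> real) \<Rightarrow> real \<Rightarrow> 'a \<Rightarrow> real" where
  "moreau_env g t x = (INF y. g y + 1 / (2 * t) * (norm (y - x))\<^sup>2)"

definition prox :: "('a::real_normed_vector \<Rightarrow> real) \<Rightarrow> real \<Rightarrow> 'a \<Rightarrow> 'a" where
  "prox g t x = (ARG_MIN (\<lambda>y. g y + 1 / (2 * t) * (norm (y - x))\<^sup>2) y. True)"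

text \<open>\<^const>\<open>infdist\<close> to the empty set is \<open>0\<close> by convention; this case does not arise here, since
  the subdifferential of a real-valued convex function on a Euclidean space is nonempty.\<close>

definition eps_stationary ::
  "(real^'n \<Rightarrow> real) \<Rightarrow> (real^'p \<Rightarrow> real) \<Rightarrow> (real^'n \<Rightarrow> real^'p) \<Rightarrow> (real^'n \<Rightarrow> real^'m) \<Rightarrow>
   real \<Rightarrow> real^'n \<Rightarrow> bool" where
  "eps_stationary f g A h \<epsilon> x \<longleftrightarrow>
     (\<exists>(v :: real^'p) (lam :: real^'m).
        Max {infdist 0 {gradient f x + transpose (jacobian A (at x)) *v w
                          + transpose (jacobian h (at x)) *v lam
                        | w. w \<in> subdifferential g (A x + v)},
             norm v, norm (h x)} < \<epsilon>)"

definition infeas :: "(real^'n \<Rightarrow> real^'m) \<Rightarrow> real^'n \<Rightarrow> real" where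
  "infeas h x = 1 / 2 * (norm (h x))\<^sup>2"

definition merit ::
  "(real^'n \<Rightarrow> real) \<Rightarrow> (real^'p \<Rightarrow> real) \<Rightarrow> (real^'n \<Rightarrow> real^'p) \<Rightarrow> (real^'n \<Rightarrow> real^'m) \<Rightarrow>
   real \<Rightarrow> real^'n \<Rightarrow> real" where
  "merit f g A h \<alpha> x = f x + g (A x) + \<alpha> * norm (h x)"

definition subproblem ::
  "(real^'n \<Rightarrow> real) \<Rightarrow> (real^'p \<Rightarrow> real) \<Rightarrow> (real^'n \<Rightarrow> real^'p) \<Rightarrow> (real^'n \<Rightarrow> real^'m) \<Rightarrow>
   real \<Rightarrow> real^'n \<Rightarrow> (real^'m) \<times> (real^'p) \<Rightarrow> real" where
  "subproblem f g A h t x = (\<lambda>(lam, \<mu>).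
     t / 2 * (norm (gradient f x + transpose (jacobian h (at x)) *v lam
                      + transpose (jacobian A (at x)) *v \<mu>))\<^sup>2
     + t / 2 * (norm \<mu>)\<^sup>2 - moreau_env g t (A x + t *\<^sub>R \<mu>))"

text \<open>\<open>correction_step\<close> relates \<open>y\<close> to every admissible trial point \<open>z\<close>; it is a relation
  because nearest points of \<open>M\<close> need not be unique.\<close>

definition correction_step ::
  "(real^'n \<Rightarrow> real^'m) \<Rightarrow> (real^'n) set \<Rightarrow> real \<Rightarrow> real \<Rightarrow> real \<Rightarrow> real^'n \<Rightarrow> real^'n \<Rightarrow> bool" where
  "correction_step h M \<theta> \<kappa> \<tau> y z \<longleftrightarrow>
     (if norm (h y) \<le> \<theta> / \<kappa> then z = y - \<tau> *\<^sub>R gradient (infeas h) y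
      else z \<in> M \<and> dist y z = infdist y M)"

text \<open>\<open>backtrack \<gamma> trial ok \<eta> \<tau> z\<close>: started with step sizes \<open>\<eta>\<close> and \<open>\<tau>\<close>, the
  inner loop stops after finitely many rejections and returns \<open>z\<close>.\<close>

inductive backtrack ::
  "real \<Rightarrow> (real \<Rightarrow> real \<Rightarrow> 'a \<Rightarrow> bool) \<Rightarrow> (real \<Rightarrow> real \<Rightarrow> 'a \<Rightarrow> bool) \<Rightarrow> real \<Rightarrow> real \<Rightarrow> 'a \<Rightarrow> bool"
  for \<gamma> trial ok where
  accept: "trial \<eta> \<tau> z \<Longrightarrow> ok \<eta> \<tau> z \<Longrightarrow> backtrack \<gamma> trial ok \<eta> \<tau> z"
| reject: "trial \<eta> \<tau> z' \<Longrightarrow> \<not> ok \<eta> \<tau> z' \<Longrightarrow> backtrack \<gamma> trial ok (\<gamma> * \<eta>) (\<gamma> / 2 * \<tau>) z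
            \<Longrightarrow> backtrack \<gamma> trial ok \<eta> \<tau> z"

definition fsipl_step ::
  "(real^'n \<Rightarrow> real) \<Rightarrow> (real^'p \<Rightarrow> real) \<Rightarrow> (real^'n \<Rightarrow> real^'p) \<Rightarrow> (real^'n \<Rightarrow> real^'m) \<Rightarrow>
   (real^'n) set \<Rightarrow> real \<Rightarrow> real \<Rightarrow> real \<Rightarrow> real \<Rightarrow> real \<Rightarrow> real \<Rightarrow> real \<Rightarrow> real \<Rightarrow>
   real \<Rightarrow> real \<Rightarrow> real \<Rightarrow> real^'n \<Rightarrow> real^'n \<Rightarrow> bool" where
  "fsipl_step f g A h M \<theta> \<kappa> l\<^sub>g \<gamma> \<alpha> \<eta>\<^sub>0 \<tau>\<^sub>0 \<sigma> t \<Delta> \<rho> x x' \<longleftrightarrow>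
     (\<exists>lam \<mu>.
        norm (gradient (subproblem f g A h t x) (lam, \<mu>)) \<le> \<Delta> \<and>
        (let d = - t *\<^sub>R (gradient f x + transpose (jacobian h (at x)) *v lam
                           + transpose (jacobian A (at x)) *v \<mu>);
             v = prox g t (A x + t *\<^sub>R \<mu>) - A x
         in backtrack \<gamma>
              (\<lambda>\<eta> \<tau> z. correction_step h M \<theta> \<kappa> \<tau> (x + \<eta> *\<^sub>R d) z)
              (\<lambda>\<eta> \<tau> z. norm (h z) \<le> \<theta> / \<kappa> \<and>
                 merit f g A h \<alpha> z \<le> merit f g A h \<alpha> x
                   - \<sigma> / 2 * (\<eta>\<^sup>2 * (norm d)\<^sup>2 + \<tau>\<^sup>2 * norm (h (x + \<eta> *\<^sub>R d)))
                   - \<eta> / (2 * t) * (norm v)\<^sup>2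
                   + \<eta> * (\<alpha> + l\<^sub>g + norm lam + norm \<mu>) * \<Delta> + \<rho>)
              \<eta>\<^sub>0 \<tau>\<^sub>0 x'))"

end

theory Submission
  imports Defs
begin

text \<open>
  Approximate optimality of the multipliers says that \<open>d\<close> is almost tangent and that \<open>v\<close> almost
  equals \<open>\<nabla>A d\<close>, and \<open>\<mu> - v/t\<close> is a subgradient of \<open>g\<close> at \<open>A x + v\<close>.  Hence the stationarity
  residual at \<open>x\<close> is controlled by \<open>\<parallel>d\<parallel>\<close>, \<open>\<parallel>v\<parallel>\<close> and \<open>\<parallel>h x\<parallel>\<close>, the pair \<open>(d, v)\<close> and the multipliers are
  bounded uniformly over all iterations, and the step along \<open>d\<close> decreases the merit function by
  \<open>\<eta>/t (\<parallel>d\<parallel>\<^sup>2 + \<parallel>v\<parallel>\<^sup>2)\<close> up to \<open>O(\<eta>\<^sup>2 \<parallel>d\<parallel>\<^sup>2)\<close> and an error proportional to \<open>\<Delta>\<close>.  The lower bound on \<open>\<alpha>\<close>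
  makes both kinds of correction step decrease it further, by \<open>\<sigma>/2 \<tau>\<^sup>2 \<parallel>h y\<parallel>\<close>.  So every trial point with
  step sizes below fixed thresholds is accepted, and the accepted step sizes are bounded away from
  zero.  Since \<open>\<parallel>h x\<parallel> \<le> \<parallel>h y\<parallel> + \<eta> \<Delta> + L\<^sub>h \<eta>\<^sup>2 \<parallel>d\<parallel>\<^sup>2\<close>, summing the acceptance test bounds
  \<open>\<Sum> (\<parallel>d\<parallel>\<^sup>2 + \<parallel>v\<parallel>\<^sup>2 + \<parallel>h x\<parallel>)\<close>, while each iterate that is not \<open>\<epsilon>\<close>-stationary contributes at least a
  fixed multiple of \<open>min \<epsilon>\<^sup>2 \<epsilon>\<close>.
\<close>

text \<open>As a simp rule this would turn each \<open>transpose B *v u\<close> into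
  \<open>u v* B\<close>; the form with \<open>transpose\<close> is the one that the estimates below
  use.\<close>

declare transpose_matrix_vector [simp del]

subsection \<open>Gradients and matrices\<close>

lemma gradient_eqI: "GDERIV f x :> D \<Longrightarrow> gradient f x = D"
  unfolding gradient_def
proof (rule the_equality)
  fix E assume D: "GDERIV f x :> D" and E: "GDERIV f x :> E"
  then have "(\<lambda>v. v \<bullet> D) = (\<lambda>v. v \<bullet> E)"
    unfolding gderiv_def by (rule has_derivative_unique)
  then have "(D - E) \<bullet> D = (D - E) \<bullet> E" by meson
  then have "(D - E) \<bullet> (D - E) = 0" by (simp add: inner_diff_right)
  then show "E = D" by simp
qed

lemma GDERIV_gradient:
  fixes f :: "'a::euclidean_space \<Rightarrow> real"
  assumes "f differentiable (at x)"
  shows "GDERIV f x :> gradient f x"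
proof -
  obtain f' where f': "(f has_derivative f') (at x)"
    using assms unfolding differentiable_def by blast
  then have "linear f'" by (rule has_derivative_linear)
  \<comment> \<open>The Riesz representative of the functional \<open>f'\<close> is its adjoint
    applied to 1.\<close>
  then have "f' v = v \<bullet> adjoint f' 1" for v
    using adjoint_works[of f' v 1] by simp
  then have "f' = (\<lambda>v. v \<bullet> adjoint f' 1)" by blast
  with f' have "GDERIV f x :> adjoint f' 1" unfolding gderiv_def by metis
  then show ?thesis using gradient_eqI by metis
qed

lemma C1_on_UNIV_differentiable: "C1_on UNIV f \<Longrightarrow> f differentiable (at x)"
  unfolding C1_on_def differentiable_def by blast

lemma norm_mult_vec_le: "norm (B *v v) \<le> spectral_norm B * norm v"
  for B :: "real^'n^'m"
  unfolding spectral_norm_def by (rule onorm) simp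

lemma inner_transpose_mult_vec: "(transpose B *v u) \<bullet> v = u \<bullet> (B *v v)" for B :: "real^'n^'m"
  by (simp add: transpose_matrix_vector dot_lmul_matrix)

lemma norm_transpose_mult_vec_le:
  fixes B :: "real^'n^'m"
  assumes "\<And>v. norm (B *v v) \<le> c * norm v"
  shows "norm (transpose B *v u) \<le> c * norm u"
proof (cases "transpose B *v u = 0")
  case True
  \<comment> \<open>Here the claim reduces to \<open>c\<close> being nonnegative, which follows by
    testing the hypothesis at a unit vector.\<close>
  have "0 \<le> c * norm (axis undefined 1 :: real^'n)"
    by (rule order_trans[OF norm_ge_zero assms])
  then have "0 \<le> c" by (simp add: zero_le_mult_iff)
  with True show ?thesis by simp
next
  case False
  let ?w = "transpose B *v u"
  have "norm ?w * norm ?w = u \<bullet> (B *v ?w)"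
    by (metis inner_transpose_mult_vec norm_eq_sqrt_inner real_sqrt_mult_self inner_ge_zero abs_of_nonneg)
  also have "\<dots> \<le> norm u * norm (B *v ?w)" by (rule norm_cauchy_schwarz)
  also have "\<dots> \<le> norm u * (c * norm ?w)" by (intro mult_left_mono assms) simp
  finally have "norm ?w * norm ?w \<le> (c * norm u) * norm ?w" by (simp add: algebra_simps)
  then show ?thesis using False by (metis mult_le_cancel_right norm_le_zero_iff not_le)
qed

text \<open>Near 0 the linear term dominates, so a small step against the sign of \<open>a\<close>
  would make the sum negative; \<open>s\<close> = -a / (1 + |b|) is small enough for every
  \<open>b\<close>. This serves as the first-order condition at a minimizer.\<close>

lemma linear_term_eq_0:
  fixes a b :: real
  assumes "\<And>s. 0 \<le> s * a + s\<^sup>2 * b"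
  shows "a = 0"
proof (rule ccontr)
  assume "a \<noteq> 0"
  define s where "s = - a / (1 + \<bar>b\<bar>)"
  have p: "1 + \<bar>b\<bar> > 0" by linarith
  have "s * a + s\<^sup>2 * b = (a\<^sup>2 / (1 + \<bar>b\<bar>)\<^sup>2) * (b - (1 + \<bar>b\<bar>))"
    using p unfolding s_def power2_eq_square by (simp add: divide_simps) (simp add: algebra_simps)
  also have "\<dots> < 0" using p \<open>a \<noteq> 0\<close> by (intro mult_pos_neg) auto
  finally show False using assms[of s] by simp
qed

text \<open>A minimizer of the Rayleigh quotient on the unit sphere is an eigenvector.\<close>

lemma symmetric_least_eigenvalue:
  fixes B :: "real^'n^'n"
  assumes sym: "transpose B = B"
  obtains e where "e \<in> eigenvalues B" "\<And>v. e * (norm v)\<^sup>2 \<le> v \<bullet> (B *v v)"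
proof -
  have "compact (sphere (0::real^'n) 1)" "sphere (0::real^'n) 1 \<noteq> {}" by auto
  moreover have "continuous_on (sphere (0::real^'n) 1) (\<lambda>v. v \<bullet> (B *v v))"
    by (intro continuous_on_inner continuous_on_id linear_continuous_on matrix_vector_mul_bounded_linear)
  ultimately obtain w where w: "norm w = 1"
    and min: "\<And>v. norm v = 1 \<Longrightarrow> w \<bullet> (B *v w) \<le> v \<bullet> (B *v v)"
    using continuous_attains_inf[of "sphere 0 1" "\<lambda>v. v \<bullet> (B *v v)"] by auto
  define e where "e = w \<bullet> (B *v w)"
  have le: "e * (norm v)\<^sup>2 \<le> v \<bullet> (B *v v)" for v
  proof (cases "v = 0")
    case False
    have "e \<le> (v /\<^sub>R norm v) \<bullet> (B *v (v /\<^sub>R norm v))"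
      unfolding e_def using False by (intro min) simp
    also have "\<dots> = v \<bullet> (B *v v) / (norm v)\<^sup>2"
      by (simp add: matrix_vector_mult_scaleR power2_eq_square field_simps)
    finally show ?thesis using False by (simp add: field_simps)
  qed simp
  have comm: "u \<bullet> (B *v v) = v \<bullet> (B *v u)" for u v
    using inner_transpose_mult_vec[of B u v] by (simp add: sym inner_commute[of v])
  \<comment> \<open>The form v . Bv - e |v|^2 is nonnegative and vanishes at \<open>w\<close>, so
    along \<open>w + s u\<close> its linear coefficient in \<open>s\<close> must vanish.\<close>
  have "2 * (u \<bullet> (B *v w - e *\<^sub>R w)) = 0" for u
  proof (rule linear_term_eq_0)
    fix s
    have "0 \<le> (w + s *\<^sub>R u) \<bullet> (B *v (w + s *\<^sub>R u)) - e * ((w + s *\<^sub>R u) \<bullet> (w + s *\<^sub>R u))"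
      using le[of "w + s *\<^sub>R u"] by (simp add: power2_norm_eq_inner)
    also have "\<dots> = w \<bullet> (B *v w) - e * (w \<bullet> w) + s * (2 * (u \<bullet> (B *v w - e *\<^sub>R w)))
                     + s\<^sup>2 * (u \<bullet> (B *v u) - e * (u \<bullet> u))"
      by (simp add: matrix_vector_right_distrib matrix_vector_mult_scaleR inner_add_left inner_add_right
          inner_diff_right comm[of w u] inner_commute[of w u])
        (simp add: power2_eq_square algebra_simps)
    finally show "0 \<le> s * (2 * (u \<bullet> (B *v w - e *\<^sub>R w))) + s\<^sup>2 * (u \<bullet> (B *v u) - e * (u \<bullet> u))"
      using w by (simp add: e_def norm_eq_1)
  qed
  then have "(B *v w - e *\<^sub>R w) \<bullet> (B *v w - e *\<^sub>R w) = 0" by simp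
  then have "B *v w = e *\<^sub>R w" by simp
  moreover have "w \<noteq> 0" using w by auto
  ultimately have "e \<in> eigenvalues B" unfolding eigenvalues_def by blast
  with le that show ?thesis by blast
qed

text \<open>The lower bound comes from the least eigenvalue of \<open>B\<close>, the upper one from
  the least eigenvalue of \<open>- B\<close>, whose negative is an eigenvalue of
  \<open>B\<close>.\<close>

lemma symmetric_quadratic_form_bounds:
  fixes B :: "real^'n^'n"
  assumes sym: "transpose B = B" and eig: "eigenvalues B \<subseteq> {a..b}"
  shows "a * (norm v)\<^sup>2 \<le> v \<bullet> (B *v v)" and "v \<bullet> (B *v v) \<le> b * (norm v)\<^sup>2"
proof -
  obtain e where e: "e \<in> eigenvalues B" "e * (norm v)\<^sup>2 \<le> v \<bullet> (B *v v)"
    using symmetric_least_eigenvalue[OF sym] by metis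
  then have "a * (norm v)\<^sup>2 \<le> e * (norm v)\<^sup>2"
    using eig by (intro mult_right_mono) auto
  with e show "a * (norm v)\<^sup>2 \<le> v \<bullet> (B *v v)" by linarith
  have neg: "(- B) *v u = - (B *v u)" for u
    by (simp add: matrix_vector_mult_def vec_eq_iff sum_negf)
  have "transpose (- B) = - B" using sym by (simp add: transpose_def vec_eq_iff)
  then obtain e' where e': "e' \<in> eigenvalues (- B)" "e' * (norm v)\<^sup>2 \<le> v \<bullet> ((- B) *v v)"
    using symmetric_least_eigenvalue by metis
  from e'(1) obtain u where "u \<noteq> 0" "- (B *v u) = e' *\<^sub>R u" unfolding eigenvalues_def neg by blast
  then have "u \<noteq> 0 \<and> B *v u = (- e') *\<^sub>R u"
    by (simp add: eq_commute[of "B *v u"] minus_equation_iff[of "B *v u"])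
  then have "- e' \<in> eigenvalues B" unfolding eigenvalues_def by blast
  then have "- e' * (norm v)\<^sup>2 \<le> b * (norm v)\<^sup>2"
    using eig by (intro mult_right_mono) auto
  with e'(2) show "v \<bullet> (B *v v) \<le> b * (norm v)\<^sup>2" by (simp add: neg)
qed

subsection \<open>Moreau envelopes\<close>

text \<open>Outside the ball of radius \<open>2 * t * l\<close> the quadratic term outweighs the
  Lipschitz variation of \<open>g\<close>, so the objective is at least its value at the centre; it
  remains to minimize over a compact ball.\<close>

lemma moreau_objective_attains_min:
  fixes g :: "'a::euclidean_space \<Rightarrow> real"
  assumes lip: "l-lipschitz_on UNIV g" and t: "t > 0"
  obtains p where "\<And>y. g p + 1 / (2 * t) * (norm (p - x))\<^sup>2 \<le> g y + 1 / (2 * t) * (norm (y - x))\<^sup>2"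
proof -
  let ?q = "\<lambda>y. g y + 1 / (2 * t) * (norm (y - x))\<^sup>2"
  have l: "0 \<le> l" using lip by (rule lipschitz_on_nonneg)
  have "continuous_on UNIV g" by (rule lipschitz_on_continuous_on[OF lip])
  then have "continuous_on (cball x (2 * t * l)) ?q"
    by (intro continuous_intros) (auto intro: continuous_on_subset)
  moreover have "cball x (2 * t * l) \<noteq> {}" using t l by (simp add: not_less)
  ultimately obtain p where p: "p \<in> cball x (2 * t * l)" and min: "\<And>y. y \<in> cball x (2 * t * l) \<Longrightarrow> ?q p \<le> ?q y"
    using continuous_attains_inf[of "cball x (2 * t * l)" ?q] by auto
  have "?q p \<le> ?q y" for y
  proof (cases "y \<in> cball x (2 * t * l)")
    case False
    let ?n = "norm (y - x)"
    have n: "?n > 2 * t * l" using False by (simp add: dist_norm norm_minus_commute)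
    have "\<bar>g x - g y\<bar> \<le> l * ?n"
      using lipschitz_onD[OF lip, of x y] by (simp add: dist_norm norm_minus_commute)
    also have "\<dots> \<le> 1 / (2 * t) * ?n\<^sup>2"
      using mult_right_mono[OF less_imp_le[OF n], of ?n] t by (simp add: field_simps power2_eq_square)
    finally have "g x \<le> ?q y" by linarith
    moreover have "?q p \<le> g x" using min[of x] t l by simp
    ultimately show ?thesis by linarith
  qed (rule min)
  with that show ?thesis by blast
qed

text \<open>\<open>prox\<close> is a Hilbert choice among minimizers, so existence of one minimizer
  makes it meaningful.\<close>

lemma prox_minimizes:
  fixes g :: "'a::euclidean_space \<Rightarrow> real"
  assumes "l-lipschitz_on UNIV g" and "t > 0"
  shows "g (prox g t x) + 1 / (2 * t) * (norm (prox g t x - x))\<^sup>2 \<le> g y + 1 / (2 * t) * (norm (y - x))\<^sup>2"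
proof -
  obtain p where p: "\<And>y. g p + 1 / (2 * t) * (norm (p - x))\<^sup>2 \<le> g y + 1 / (2 * t) * (norm (y - x))\<^sup>2"
    using moreau_objective_attains_min[OF assms] by blast
  have "is_arg_min (\<lambda>y. g y + 1 / (2 * t) * (norm (y - x))\<^sup>2) (\<lambda>_. True) p"
    unfolding is_arg_min_linorder using p by blast
  then have "is_arg_min (\<lambda>y. g y + 1 / (2 * t) * (norm (y - x))\<^sup>2) (\<lambda>_. True) (prox g t x)"
    unfolding prox_def arg_min_def by (rule someI)
  then show ?thesis unfolding is_arg_min_linorder by blast
qed

lemma moreau_env_eq_prox:
  fixes g :: "'a::euclidean_space \<Rightarrow> real"
  assumes "l-lipschitz_on UNIV g" and "t > 0"
  shows "moreau_env g t x = g (prox g t x) + 1 / (2 * t) * (norm (prox g t x - x))\<^sup>2"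
  unfolding moreau_env_def
  by (rule cInf_eq_minimum) (use prox_minimizes[OF assms] in auto)

text \<open>Compare the proximal point with its move by a fraction \<open>s\<close> towards
  \<open>y\<close>, bound \<open>g\<close> there by convexity, divide by \<open>s\<close>, and let
  \<open>s\<close> tend to 0 from the right.\<close>

lemma prox_subgradient:
  fixes g :: "'a::euclidean_space \<Rightarrow> real"
  assumes lip: "l-lipschitz_on UNIV g" and t: "t > 0" and conv: "convex_on UNIV g"
  shows "(x - prox g t x) /\<^sub>R t \<in> subdifferential g (prox g t x)"
  unfolding subdifferential_def
proof safe
  fix y
  let ?p = "prox g t x" and ?u = "(x - prox g t x) /\<^sub>R t"
  let ?b = "g y - g ?p - ?u \<bullet> (y - ?p)" and ?c = "(norm (y - ?p))\<^sup>2 / (2 * t)"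
  have s: "0 \<le> ?b + s * ?c" if "0 < s" "s < 1" for s
  proof -
    let ?z = "?p + s *\<^sub>R (y - ?p)"
    have z: "?z = (1 - s) *\<^sub>R ?p + s *\<^sub>R y" by (simp add: algebra_simps)
    have "g ?z \<le> (1 - s) * g ?p + s * g y"
      unfolding z using that by (intro convex_onD[OF conv]) auto
    moreover have "g ?p + 1 / (2 * t) * (norm (?p - x))\<^sup>2 \<le> g ?z + 1 / (2 * t) * (norm (?z - x))\<^sup>2"
      by (rule prox_minimizes[OF lip t])
    moreover have "1 / (2 * t) * (norm (?z - x))\<^sup>2
        = 1 / (2 * t) * (norm (?p - x))\<^sup>2 + s * (s * ?c - ?u \<bullet> (y - ?p))"
    proof -
      have "?z - x = s *\<^sub>R (y - ?p) - (x - ?p)" by simp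
      then have "(norm (?z - x))\<^sup>2
          = (norm (?p - x))\<^sup>2 - 2 * s * ((x - ?p) \<bullet> (y - ?p)) + s\<^sup>2 * (norm (y - ?p))\<^sup>2"
        unfolding norm_minus_commute[of ?p x] power2_norm_eq_inner
        by (simp only: inner_diff_left[of "s *\<^sub>R (y - ?p)"] inner_diff_right[of _ "s *\<^sub>R (y - ?p)"]
            inner_scaleR_left inner_scaleR_right inner_commute[of "x - ?p" "y - ?p"])
          (simp add: power2_eq_square algebra_simps)
      then show ?thesis using t by (simp only: inner_scaleR_left) (simp add: field_simps power2_eq_square)
    qed
    ultimately have "0 \<le> s * (?b + s * ?c)"
      by (simp add: algebra_simps)
    with that show ?thesis by (simp add: zero_le_mult_iff)
  qed
  have "((\<lambda>s. ?b + s * ?c) \<longlongrightarrow> ?b + 0 * ?c) (at_right 0)"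
    by (intro tendsto_intros)
  moreover have "eventually (\<lambda>s. 0 \<le> ?b + s * ?c) (at_right 0)"
    unfolding eventually_at_right[OF zero_less_one] by (intro exI[of _ 1] conjI allI impI s) auto
  ultimately have "0 \<le> ?b + 0 * ?c"
    by (rule tendsto_lowerbound) simp
  then show "g ?p + ?u \<bullet> (y - ?p) \<le> g y" by simp
qed

text \<open>Lets the derivative of a Moreau envelope be read off from a two-sided quadratic
  estimate.\<close>

lemma has_derivativeI_quadratic:
  fixes f :: "'a::real_normed_vector \<Rightarrow> 'b::real_normed_vector"
  assumes lin: "bounded_linear f'" and bd: "\<And>y. norm (f y - f x - f' (y - x)) \<le> c * (norm (y - x))\<^sup>2"
  shows "(f has_derivative f') (at x)"
  unfolding has_derivative_at2
proof (intro conjI lin)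
  have "((\<lambda>y. c * norm (y - x)) \<longlongrightarrow> c * norm (x - x)) (at x)" by (intro tendsto_intros)
  then have lim: "((\<lambda>y. c * norm (y - x)) \<longlongrightarrow> 0) (at x)" by simp
  show "((\<lambda>y. (1 / norm (y - x)) *\<^sub>R (f y - (f x + f' (y - x)))) \<longlongrightarrow> 0) (at x)"
  proof (rule tendsto_norm_zero_cancel, rule tendsto_sandwich[OF _ _ tendsto_const lim])
    show "\<forall>\<^sub>F y in at x. norm ((1 / norm (y - x)) *\<^sub>R (f y - (f x + f' (y - x)))) \<le> c * norm (y - x)"
    proof (rule eventually_at_topological[THEN iffD2], intro exI[of _ UNIV] conjI ballI impI)
      fix y assume "y \<noteq> x"
      then show "norm ((1 / norm (y - x)) *\<^sub>R (f y - (f x + f' (y - x)))) \<le> c * norm (y - x)"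
        using bd[of y] by (simp add: divide_simps power2_eq_square diff_diff_eq mult.assoc)
    qed auto
  qed auto
qed

text \<open>The linearization error lies between 0 and |y - x|^2 / (2t). The lower bound expands the
  square |q - y + t u|^2 and uses that \<open>u\<close> is a subgradient at the proximal point
  \<open>?p\<close> of \<open>x\<close>; the upper bound uses \<open>?p\<close> as a competitor in
  the problem at \<open>y\<close>.\<close>

lemma GDERIV_moreau_env:
  fixes g :: "'a::euclidean_space \<Rightarrow> real"
  assumes lip: "l-lipschitz_on UNIV g" and t: "t > 0" and conv: "convex_on UNIV g"
  shows "GDERIV (moreau_env g t) x :> (x - prox g t x) /\<^sub>R t"
  unfolding gderiv_def
proof (rule has_derivativeI_quadratic)
  fix y
  let ?p = "prox g t x" and ?q = "prox g t y" and ?u = "(x - prox g t x) /\<^sub>R t"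
  let ?D = "moreau_env g t y - moreau_env g t x - (y - x) \<bullet> ?u"
  define u where "u = ?u"
  have p: "?p = x - t *\<^sub>R u" using t by (simp add: u_def)
  have Mx: "moreau_env g t x = g ?p + t / 2 * (norm u)\<^sup>2"
    using t unfolding moreau_env_eq_prox[OF lip t] by (simp add: p power_mult_distrib field_simps power2_eq_square)
  have "0 \<le> 1 / (2 * t) * (norm (?q - y + t *\<^sub>R u))\<^sup>2" using t by simp
  also have "\<dots> = 1 / (2 * t) * (norm (?q - y))\<^sup>2 + u \<bullet> (?q - y) + t / 2 * (norm u)\<^sup>2"
    using t unfolding power2_norm_eq_inner
    by (simp add: inner_simps inner_commute field_simps)
  also have "u \<bullet> (?q - y) = u \<bullet> (?q - ?p) - t * (norm u)\<^sup>2 - u \<bullet> (y - x)"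
    unfolding p power2_norm_eq_inner by (simp add: inner_simps algebra_simps)
  also have "u \<bullet> (?q - ?p) \<le> g ?q - g ?p"
    using prox_subgradient[OF lip t conv, of x] unfolding subdifferential_def u_def by (auto simp: algebra_simps)
  finally have lower: "0 \<le> ?D"
    unfolding Mx moreau_env_eq_prox[OF lip t, of y] u_def[symmetric] by (simp add: inner_commute)
  have "moreau_env g t y \<le> g ?p + 1 / (2 * t) * (norm (?p - y))\<^sup>2"
    unfolding moreau_env_eq_prox[OF lip t, of y] by (rule prox_minimizes[OF lip t])
  also have "1 / (2 * t) * (norm (?p - y))\<^sup>2
      = t / 2 * (norm u)\<^sup>2 + u \<bullet> (y - x) + 1 / (2 * t) * (norm (y - x))\<^sup>2"
    using t unfolding p power2_norm_eq_inner
    by (simp add: inner_simps inner_commute field_simps)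
  finally have "?D \<le> 1 / (2 * t) * (norm (y - x))\<^sup>2"
    unfolding Mx u_def[symmetric] by (simp add: inner_commute)
  with lower show "norm (moreau_env g t y - moreau_env g t x - (y - x) \<bullet> ?u) \<le> 1 / (2 * t) * (norm (y - x))\<^sup>2"
    by simp
qed (rule bounded_linear_inner_left)

section \<open>Taylor bounds, subgradient bounds, and gradients of the infeasibility and of the
  subproblem\<close>

lemma taylor_bound:
  fixes f :: "'a::real_normed_vector \<Rightarrow> 'b::real_normed_vector"
  assumes der: "\<And>u. (f has_derivative f' u) (at u)"
    and lip: "\<And>u v. norm (f' u v - f' x v) \<le> L * norm (u - x) * norm v" and L: "0 \<le> L"
  shows "norm (f y - f x - f' x (y - x)) \<le> L * (norm (y - x))\<^sup>2"
proof -
  \<comment> \<open>The mean value inequality for \<open>f\<close> minus its linearization at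
    \<open>x\<close> takes the place of an integral; hence the constant \<open>L\<close> rather than
    L/2.\<close>
  have "norm (f y - f x - f' x (y - x)) \<le> norm (y - x) * (L * norm (y - x))"
  proof (rule differentiable_bound_linearization[where S = "closed_segment x y"])
    show "x + s *\<^sub>R (y - x) \<in> closed_segment x y" if "s \<in> {0..1}" for s
      using that unfolding in_segment by (intro exI[of _ s]) (simp add: algebra_simps)
    fix u assume u: "u \<in> closed_segment x y"
    show "onorm (f' u - f' x) \<le> L * norm (y - x)"
    proof (rule onorm_bound)
      fix v :: 'a
      have "L * norm (u - x) * norm v \<le> L * norm (y - x) * norm v"
        using L segment_bound1[OF u] by (intro mult_right_mono mult_left_mono) auto
      with lip[of u v] show "norm ((f' u - f' x) v) \<le> L * norm (y - x) * norm v" by simp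
    qed (use L in simp)
  qed (auto intro: has_derivative_at_withinI der)
  then show ?thesis by (simp add: power2_eq_square algebra_simps)
qed

lemma subgradient_norm_le:
  fixes g :: "'a::euclidean_space \<Rightarrow> real"
  assumes lip: "l-lipschitz_on UNIV g" and w: "w \<in> subdifferential g q"
  shows "norm w \<le> l"
proof (cases "w = 0")
  case True
  then show ?thesis using lipschitz_on_nonneg[OF lip] by simp
next
  case False
  \<comment> \<open>The subgradient inequality in the direction \<open>w\<close> itself forces |w|^2
    \<le> l |w|.\<close>
  have "g q + w \<bullet> w \<le> g (q + w)" using w unfolding subdifferential_def by (auto dest: spec[of _ "q + w"])
  moreover have "\<bar>g (q + w) - g q\<bar> \<le> l * norm w"
    using lipschitz_onD[OF lip, of "q + w" q] by (simp add: dist_norm)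
  ultimately have "norm w * norm w \<le> l * norm w" by (simp add: norm_eq_square[symmetric] dot_square_norm power2_eq_square)
  then show ?thesis using False by simp
qed

lemma gradient_infeas:
  assumes "(h has_derivative (\<lambda>v. B *v v)) (at y)"
  shows "gradient (infeas h) y = transpose B *v h y"
proof (rule gradient_eqI)
  have "((\<lambda>x. 1 / 2 * (h x \<bullet> h x)) has_derivative (\<lambda>v. v \<bullet> (transpose B *v h y))) (at y)"
    by (rule has_derivative_eq_rhs, (rule derivative_intros assms)+)
      (auto simp: inner_transpose_mult_vec inner_commute[of _ "transpose B *v h y"] inner_commute[of "B *v _"])
  then show "GDERIV (infeas h) y :> transpose B *v h y"
    unfolding gderiv_def infeas_def[abs_def] power2_norm_eq_inner .
qed

text \<open>In the second component the \<open>t *\<^sub>R \<mu>\<close> from the quadratic term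
  cancels the one in the gradient of the envelope. With d = -t c and v = prox - A x the two
  components are -J d and v - K d, so the inexactness test measures exactly how far \<open>d\<close>
  is from tangent and \<open>v\<close> from K d.\<close>

lemma gradient_subproblem:
  fixes f :: "real^'n \<Rightarrow> real" and g :: "real^'p \<Rightarrow> real"
    and A :: "real^'n \<Rightarrow> real^'p" and h :: "real^'n \<Rightarrow> real^'m"
    and x :: "real^'n" and lam :: "real^'m" and \<mu> :: "real^'p"
  assumes lip: "l-lipschitz_on UNIV g" and t: "t > 0" and conv: "convex_on UNIV g"
  defines "c \<equiv> gradient f x + transpose (jacobian h (at x)) *v lam + transpose (jacobian A (at x)) *v \<mu>"
  shows "gradient (subproblem f g A h t x) (lam, \<mu>) =
    (t *\<^sub>R (jacobian h (at x) *v c),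
     t *\<^sub>R (jacobian A (at x) *v c) + prox g t (A x + t *\<^sub>R \<mu>) - A x)"
proof (rule gradient_eqI)
  let ?J = "jacobian h (at x)" and ?K = "jacobian A (at x)"
  let ?c = "\<lambda>p. gradient f x + transpose ?J *v fst p + transpose ?K *v snd p"
  let ?z = "A x + t *\<^sub>R \<mu>"
  let ?u = "(?z - prox g t ?z) /\<^sub>R t"
  have c: "(?c has_derivative (\<lambda>v. transpose ?J *v fst v + transpose ?K *v snd v)) (at (lam, \<mu>))"
    by (rule has_derivative_eq_rhs,
        (rule derivative_intros bounded_linear.has_derivative[OF matrix_vector_mul_bounded_linear])+) simp
  have z: "((\<lambda>p. A x + t *\<^sub>R snd p) has_derivative (\<lambda>v. t *\<^sub>R snd v)) (at (lam, \<mu>))"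
    by (auto intro!: derivative_eq_intros)
  have m: "(moreau_env g t has_derivative (\<lambda>v. v \<bullet> ?u)) (at ?z)"
    using GDERIV_moreau_env[OF lip t conv] unfolding gderiv_def .
  have mz: "((\<lambda>p. moreau_env g t (A x + t *\<^sub>R snd p)) has_derivative (\<lambda>v. (t *\<^sub>R snd v) \<bullet> ?u)) (at (lam, \<mu>))"
    using has_derivative_compose[OF z, of "moreau_env g t" "\<lambda>v. v \<bullet> ?u"] m by simp
  let ?D = "(t *\<^sub>R (?J *v c), t *\<^sub>R (?K *v c) + prox g t ?z - A x)"
  have "((\<lambda>p. t / 2 * (?c p \<bullet> ?c p) + t / 2 * (snd p \<bullet> snd p) - moreau_env g t (A x + t *\<^sub>R snd p))
      has_derivative (\<lambda>v. v \<bullet> ?D)) (at (lam, \<mu>))"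
  proof (rule has_derivative_eq_rhs, (rule derivative_intros c mz)+, rule ext)
    fix v :: "(real^'m) \<times> (real^'p)"
    obtain a b where v: "v = (a, b)" by fastforce
    have J: "(transpose ?J *v a) \<bullet> c = a \<bullet> (?J *v c)"
      and K: "(transpose ?K *v b) \<bullet> c = b \<bullet> (?K *v c)"
      by (rule inner_transpose_mult_vec)+
    have u: "(t *\<^sub>R b) \<bullet> ?u = b \<bullet> (A x + t *\<^sub>R \<mu> - prox g t ?z)"
      using t by simp
    show "t / 2 * (?c (lam, \<mu>) \<bullet> (transpose ?J *v fst v + transpose ?K *v snd v)
            + (transpose ?J *v fst v + transpose ?K *v snd v) \<bullet> ?c (lam, \<mu>))
          + t / 2 * (snd (lam, \<mu>) \<bullet> snd v + snd v \<bullet> snd (lam, \<mu>))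
          - (t *\<^sub>R snd v) \<bullet> ?u = v \<bullet> ?D"
      unfolding v fst_conv snd_conv u c_def[symmetric] inner_Pair
      by (simp add: inner_add_left inner_add_right inner_diff_right inner_commute[of c]
          inner_commute[of \<mu>] J K algebra_simps)
  qed
  then show "GDERIV (subproblem f g A h t x) (lam, \<mu>) :> ?D"
    unfolding gderiv_def subproblem_def power2_norm_eq_inner case_prod_beta by simp
qed

subsection \<open>Local models of the problem data\<close>

text \<open>Collects the data of the problem apart from the algorithm. Nonemptiness of
  \<open>M\<close> keeps the tubes compact, since \<open>infdist\<close> to the empty set is 0; in
  the theorem it comes from the starting point.\<close>

locale fsipl_problem =
  fixes f :: "real^'n \<Rightarrow> real" and g :: "real^'p \<Rightarrow> real"
    and A :: "real^'n \<Rightarrow> real^'p" and h :: "real^'n \<Rightarrow> real^'m"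
    and M :: "(real^'n) set"
    and \<kappa> \<theta> C\<^sub>1 C\<^sub>2 L\<^sub>h L\<^sub>f L\<^sub>A l\<^sub>f l\<^sub>g l\<^sub>A :: real
  assumes compact_M: "compact M" and M_nonempty: "M \<noteq> {}"
    and C1_f: "C1_on UNIV f" and C1_A: "C1_on UNIV A" and C1_h: "C1_on UNIV h"
    and convex_g: "convex_on UNIV g"
    and M_eq: "M = {z. h z = 0}"
    and \<kappa>_pos: "\<kappa> > 0" and error_bound: "infdist z M \<le> \<kappa> * norm (h z)"
    and L\<^sub>h_pos: "L\<^sub>h > 0"
    and jacobian_h_lipschitz:
      "spectral_norm (jacobian h (at y) - jacobian h (at z)) \<le> L\<^sub>h * dist y z"
    and \<theta>_pos: "\<theta> > 0" and C\<^sub>1_pos: "0 < C\<^sub>1" and C\<^sub>1_le_C\<^sub>2: "C\<^sub>1 \<le> C\<^sub>2"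
    and eigenvalues_bounds: "z \<in> tube M (2 * \<theta>) \<Longrightarrow>
           eigenvalues (jacobian h (at z) ** transpose (jacobian h (at z))) \<subseteq> {C\<^sub>1..C\<^sub>2}"
    and gradient_f_lipschitz: "L\<^sub>f-lipschitz_on UNIV (gradient f)"
    and g_lipschitz: "l\<^sub>g-lipschitz_on UNIV g"
    and jacobian_A_lipschitz:
      "spectral_norm (jacobian A (at y) - jacobian A (at z)) \<le> L\<^sub>A * dist y z"
    and l\<^sub>f_pos: "l\<^sub>f > 0" and gradient_f_le: "z \<in> tube M (2 * \<theta>) \<Longrightarrow> norm (gradient f z) \<le> l\<^sub>f"
    and l\<^sub>A_pos: "l\<^sub>A > 0" and jacobian_A_le: "z \<in> tube M (2 * \<theta>) \<Longrightarrow> spectral_norm (jacobian A (at z)) \<le> l\<^sub>A"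
begin

abbreviation J where "J x \<equiv> jacobian h (at x)"
abbreviation K where "K x \<equiv> jacobian A (at x)"
abbreviation F where "F x \<equiv> f x + g (A x)"

lemma C\<^sub>2_pos: "C\<^sub>2 > 0" using C\<^sub>1_pos C\<^sub>1_le_C\<^sub>2 by linarith

lemma l\<^sub>g_nonneg: "0 \<le> l\<^sub>g" using g_lipschitz by (rule lipschitz_on_nonneg)

lemma L\<^sub>f_nonneg: "0 \<le> L\<^sub>f" using gradient_f_lipschitz by (rule lipschitz_on_nonneg)

lemma jacobian_diff_apply_le:
  assumes "spectral_norm (P - Q) \<le> c"
  shows "norm (P *v v - Q *v v) \<le> c * norm v"
proof -
  have "norm ((P - Q) *v v) \<le> spectral_norm (P - Q) * norm v" by (rule norm_mult_vec_le)
  also have "\<dots> \<le> c * norm v" using assms by (rule mult_right_mono) simp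
  finally show ?thesis by (simp add: matrix_vector_mult_diff_rdistrib)
qed

lemma f_has_derivative: "(f has_derivative (\<lambda>v. v \<bullet> gradient f u)) (at u)"
  using GDERIV_gradient[OF C1_on_UNIV_differentiable[OF C1_f]] unfolding gderiv_def .

lemma A_has_derivative: "(A has_derivative (\<lambda>v. K u *v v)) (at u)"
  using C1_on_UNIV_differentiable[OF C1_A] jacobian_works by blast

lemma h_has_derivative: "(h has_derivative (\<lambda>v. J u *v v)) (at u)"
  using C1_on_UNIV_differentiable[OF C1_h] jacobian_works by blast

lemma f_taylor: "norm (f y - f x - (y - x) \<bullet> gradient f x) \<le> L\<^sub>f * (norm (y - x))\<^sup>2"
proof (rule taylor_bound[OF f_has_derivative _ L\<^sub>f_nonneg])
  fix u v :: "real^'n"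
  have "norm (v \<bullet> gradient f u - v \<bullet> gradient f x) \<le> norm v * norm (gradient f u - gradient f x)"
    unfolding inner_diff_right[symmetric] real_norm_def by (rule Cauchy_Schwarz_ineq2)
  also have "\<dots> \<le> norm v * (L\<^sub>f * norm (u - x))"
    using lipschitz_onD[OF gradient_f_lipschitz, of u x] by (intro mult_left_mono) (auto simp: dist_norm)
  finally show "norm (v \<bullet> gradient f u - v \<bullet> gradient f x) \<le> L\<^sub>f * norm (u - x) * norm v"
    by (simp add: mult_ac)
qed

text \<open>The sign of \<open>L\<^sub>A\<close> is not prescribed, whereas
  \<open>taylor_bound\<close> asks for a nonnegative constant; hence the absolute value.\<close>

lemma A_taylor: "norm (A y - A x - K x *v (y - x)) \<le> \<bar>L\<^sub>A\<bar> * (norm (y - x))\<^sup>2"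
proof (rule taylor_bound[OF A_has_derivative _ abs_ge_zero])
  fix u v :: "real^'n"
  have "L\<^sub>A * dist u x \<le> \<bar>L\<^sub>A\<bar> * norm (u - x)" by (simp add: dist_norm mult_right_mono)
  then show "norm (K u *v v - K x *v v) \<le> \<bar>L\<^sub>A\<bar> * norm (u - x) * norm v"
    by (intro jacobian_diff_apply_le order_trans[OF jacobian_A_lipschitz])
qed

lemma h_taylor: "norm (h y - h x - J x *v (y - x)) \<le> L\<^sub>h * (norm (y - x))\<^sup>2"
proof (rule taylor_bound[OF h_has_derivative])
  fix u v :: "real^'n"
  show "norm (J u *v v - J x *v v) \<le> L\<^sub>h * norm (u - x) * norm v"
    using jacobian_h_lipschitz[of u x] by (intro jacobian_diff_apply_le) (simp add: dist_norm)
qed (use L\<^sub>h_pos in simp)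

text \<open>The eigenvalue bounds become norm bounds because u . (J J^T u) = |J^T u|^2.\<close>

lemma
  assumes "z \<in> tube M (2 * \<theta>)"
  shows jacobian_h_transpose_lower: "sqrt C\<^sub>1 * norm u \<le> norm (transpose (J z) *v u)"
    and jacobian_h_transpose_upper: "norm (transpose (J z) *v u) \<le> sqrt C\<^sub>2 * norm u"
proof -
  let ?B = "J z ** transpose (J z)"
  have sym: "transpose ?B = ?B" by (simp add: matrix_transpose_mul)
  have "u \<bullet> (?B *v u) = (norm (transpose (J z) *v u))\<^sup>2"
    by (simp add: matrix_vector_mul_assoc[symmetric] inner_transpose_mult_vec[symmetric] power2_norm_eq_inner)
  then have sq: "C\<^sub>1 * (norm u)\<^sup>2 \<le> (norm (transpose (J z) *v u))\<^sup>2"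
      "(norm (transpose (J z) *v u))\<^sup>2 \<le> C\<^sub>2 * (norm u)\<^sup>2"
    using symmetric_quadratic_form_bounds[OF sym eigenvalues_bounds[OF assms], of u] by simp_all
  show "sqrt C\<^sub>1 * norm u \<le> norm (transpose (J z) *v u)"
    by (rule power2_le_imp_le) (use sq C\<^sub>1_pos in \<open>simp_all add: power_mult_distrib\<close>)
  show "norm (transpose (J z) *v u) \<le> sqrt C\<^sub>2 * norm u"
    by (rule power2_le_imp_le) (use sq C\<^sub>2_pos in \<open>simp_all add: power_mult_distrib\<close>)
qed

lemma jacobian_h_upper: "z \<in> tube M (2 * \<theta>) \<Longrightarrow> norm (J z *v v) \<le> sqrt C\<^sub>2 * norm v"
  using norm_transpose_mult_vec_le[of "transpose (J z)" "sqrt C\<^sub>2" v] jacobian_h_transpose_upper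
  by simp

lemma jacobian_A_apply_le: "z \<in> tube M (2 * \<theta>) \<Longrightarrow> norm (K z *v v) \<le> l\<^sub>A * norm v"
  using jacobian_A_le[of z] norm_mult_vec_le[of "K z" v] by (meson mult_right_mono norm_ge_zero order_trans)

lemma jacobian_A_transpose_le:
  "z \<in> tube M (2 * \<theta>) \<Longrightarrow> norm (transpose (K z) *v w) \<le> l\<^sub>A * norm w"
  using norm_transpose_mult_vec_le jacobian_A_apply_le by metis

text \<open>The derivative bounds on \<open>f\<close> and \<open>A\<close> hold only in the tube, so
  the mean value inequality needs the whole segment inside it; \<open>g\<close> is Lipschitz
  everywhere.\<close>

lemma F_lipschitz_on_segment:
  assumes seg: "closed_segment y z \<subseteq> tube M (2 * \<theta>)"
  shows "\<bar>F z - F y\<bar> \<le> (l\<^sub>f + l\<^sub>g * l\<^sub>A) * norm (z - y)"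
proof -
  have "norm (f z - f y) \<le> l\<^sub>f * norm (z - y)"
  proof (rule differentiable_bound[where S = "closed_segment y z"])
    fix u assume "u \<in> closed_segment y z"
    then have "norm (gradient f u) \<le> l\<^sub>f" using seg gradient_f_le by blast
    then have "norm v * norm (gradient f u) \<le> l\<^sub>f * norm v" for v :: "real^'n"
      by (simp add: mult.commute[of l\<^sub>f] mult_left_mono)
    then show "onorm (\<lambda>v. v \<bullet> gradient f u) \<le> l\<^sub>f"
      using l\<^sub>f_pos unfolding real_norm_def
      by (intro onorm_bound) (auto intro: order_trans[OF Cauchy_Schwarz_ineq2])
  qed (auto intro: has_derivative_at_withinI f_has_derivative)
  moreover have "norm (A z - A y) \<le> l\<^sub>A * norm (z - y)"
  proof (rule differentiable_bound[where S = "closed_segment y z"])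
    fix u assume "u \<in> closed_segment y z"
    then show "onorm (\<lambda>v. K u *v v) \<le> l\<^sub>A"
      using seg l\<^sub>A_pos by (intro onorm_bound jacobian_A_apply_le) auto
  qed (auto intro: has_derivative_at_withinI A_has_derivative)
  then have "l\<^sub>g * norm (A z - A y) \<le> l\<^sub>g * (l\<^sub>A * norm (z - y))"
    using l\<^sub>g_nonneg by (rule mult_left_mono)
  moreover have "\<bar>g (A z) - g (A y)\<bar> \<le> l\<^sub>g * norm (A z - A y)"
    using lipschitz_onD[OF g_lipschitz, of "A z" "A y"] by (simp add: dist_norm)
  ultimately show ?thesis unfolding real_norm_def distrib_right mult.assoc by linarith
qed

text \<open>\<open>F\<close> is continuous and the tube compact, and the penalty term is
  nonnegative.\<close>

lemma merit_bounded_below: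
  assumes "\<alpha> \<ge> 0"
  obtains b where "\<And>z. z \<in> tube M (2 * \<theta>) \<Longrightarrow> b \<le> merit f g A h \<alpha> z"
proof -
  have "compact (tube M (2 * \<theta>))"
    unfolding tube_def using compact_infdist_le[OF M_nonempty compact_M] \<theta>_pos by simp
  moreover obtain m where "m \<in> M" using M_nonempty by blast
  then have "m \<in> tube M (2 * \<theta>)" using \<theta>_pos by (simp add: tube_def)
  then have "tube M (2 * \<theta>) \<noteq> {}" by blast
  moreover have "continuous_on UNIV F"
  proof -
    have "continuous_on UNIV f" "continuous_on UNIV A"
      by (auto intro!: continuous_at_imp_continuous_on has_derivative_continuous f_has_derivative A_has_derivative)
    moreover have "continuous_on UNIV g" by (rule lipschitz_on_continuous_on[OF g_lipschitz])
    ultimately show ?thesis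
      by (intro continuous_on_add) (auto intro: continuous_on_compose2)
  qed
  ultimately obtain z0 where z0: "\<And>z. z \<in> tube M (2 * \<theta>) \<Longrightarrow> F z0 \<le> F z"
    using continuous_attains_inf[of "tube M (2 * \<theta>)" F] continuous_on_subset[OF _ subset_UNIV] by blast
  show thesis
    by (rule that[of "F z0"], unfold merit_def, drule z0) (use assms in \<open>simp add: add_increasing2\<close>)
qed

end

subsection \<open>Search directions\<close>

context fsipl_problem
begin

text \<open>\<open>direction_bound T E\<close> is \<open>1 + 2 (a + b)\<close> for the energy inequality
  \<open>\<parallel>d\<parallel>\<^sup>2 + \<parallel>v\<parallel>\<^sup>2 \<le> a (\<parallel>d\<parallel> + \<parallel>v\<parallel>) + b\<close>, valid when \<open>t \<le> T\<close> and \<open>\<Delta> \<le> E\<close>.\<close>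

definition direction_bound :: "real \<Rightarrow> real \<Rightarrow> real" where
  "direction_bound T E = 1 + 2 * (T * (l\<^sub>f + l\<^sub>g * l\<^sub>A) + E + E * (1 + l\<^sub>A) / sqrt C\<^sub>1
     + E * T * (l\<^sub>f + l\<^sub>A * l\<^sub>g) / sqrt C\<^sub>1)"

text \<open>Bounds the sum of the two multiplier norms when t lies between \<open>T\<^sub>0\<close>
  and \<open>T\<close>: the first summand is the bound on t |lam| divided by
  \<open>T\<^sub>0\<close>, the other two bound \<mu> = w + v/t.\<close>

definition multiplier_bound :: "real \<Rightarrow> real \<Rightarrow> real \<Rightarrow> real" where
  "multiplier_bound T\<^sub>0 T E =
     ((1 + l\<^sub>A) * direction_bound T E + T * (l\<^sub>f + l\<^sub>A * l\<^sub>g)) / sqrt C\<^sub>1 / T\<^sub>0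
     + l\<^sub>g + direction_bound T E / T\<^sub>0"

lemma tube_mono: "z \<in> tube M \<theta> \<Longrightarrow> z \<in> tube M (2 * \<theta>)"
  using \<theta>_pos unfolding tube_def by simp

end

text \<open>Fixes a single iterate near \<open>M\<close> with multipliers that pass the inexactness
  test, so that the estimates are free of the sequence of iterates.\<close>

locale fsipl_direction = fsipl_problem f g A h M \<kappa> \<theta> C\<^sub>1 C\<^sub>2 L\<^sub>h L\<^sub>f L\<^sub>A l\<^sub>f l\<^sub>g l\<^sub>A
  for f :: "real^'n \<Rightarrow> real" and g :: "real^'p \<Rightarrow> real"
    and A :: "real^'n \<Rightarrow> real^'p" and h :: "real^'n \<Rightarrow> real^'m"
    and M \<kappa> \<theta> C\<^sub>1 C\<^sub>2 L\<^sub>h L\<^sub>f L\<^sub>A l\<^sub>f l\<^sub>g l\<^sub>A +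
  fixes x :: "real^'n" and lam :: "real^'m" and \<mu> :: "real^'p" and t \<Delta> :: real
  assumes x_in_tube: "x \<in> tube M \<theta>" and t_pos: "t > 0"
    and gradient_subproblem_le: "norm (gradient (subproblem f g A h t x) (lam, \<mu>)) \<le> \<Delta>"
begin

definition d where
  "d = - t *\<^sub>R (gradient f x + transpose (J x) *v lam + transpose (K x) *v \<mu>)"

definition v where "v = prox g t (A x + t *\<^sub>R \<mu>) - A x"

text \<open>This equals (z - prox z)/t at z = A x + t \<mu>, the gradient of the Moreau envelope and
  hence a subgradient of \<open>g\<close> at \<open>A x + v\<close>.\<close>

definition w where "w = \<mu> - v /\<^sub>R t"

lemmas x_in = tube_mono[OF x_in_tube]

lemma \<Delta>_nonneg: "0 \<le> \<Delta>"
  using gradient_subproblem_le norm_ge_zero order_trans by blast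

lemma J_d_le: "norm (J x *v d) \<le> \<Delta>"
  and v_K_d_le: "norm (v - K x *v d) \<le> \<Delta>"
proof -
  let ?c = "gradient f x + transpose (J x) *v lam + transpose (K x) *v \<mu>"
  have *: "P *v d = - (t *\<^sub>R (P *v ?c))" for P :: "real^'n^'k"
    unfolding d_def by (simp only: matrix_vector_mult_scaleR) simp
  have G: "gradient (subproblem f g A h t x) (lam, \<mu>) = (- (J x *v d), v - K x *v d)"
    unfolding gradient_subproblem[OF g_lipschitz t_pos convex_g] v_def * by simp
  show "norm (J x *v d) \<le> \<Delta>" "norm (v - K x *v d) \<le> \<Delta>"
    using norm_fst_le[of "- (J x *v d)" "v - K x *v d"] norm_snd_le[of "v - K x *v d" "- (J x *v d)"]
      gradient_subproblem_le unfolding G by auto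
qed

lemma w_subgradient: "w \<in> subdifferential g (A x + v)"
proof -
  have "w = (A x + t *\<^sub>R \<mu> - prox g t (A x + t *\<^sub>R \<mu>)) /\<^sub>R t"
    using t_pos unfolding w_def v_def by (simp add: algebra_simps)
  then show ?thesis
    using prox_subgradient[OF g_lipschitz t_pos convex_g, of "A x + t *\<^sub>R \<mu>"] by (simp add: v_def)
qed

lemma w_le: "norm w \<le> l\<^sub>g"
  by (rule subgradient_norm_le[OF g_lipschitz w_subgradient])

lemma t_\<mu>: "t *\<^sub>R \<mu> = t *\<^sub>R w + v"
  using t_pos unfolding w_def by (simp add: algebra_simps)

text \<open>Expand |d|^2 after replacing one of the two factors by the definition of
  \<open>d\<close>.\<close>

lemma t_inner_gradient_d:
  "t * (gradient f x \<bullet> d) = - (norm d)\<^sup>2 - t * (lam \<bullet> (J x *v d)) - t * (\<mu> \<bullet> (K x *v d))"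
proof -
  have "(norm d)\<^sup>2 = (- t *\<^sub>R (gradient f x + transpose (J x) *v lam + transpose (K x) *v \<mu>)) \<bullet> d"
    unfolding d_def[symmetric] by (rule power2_norm_eq_inner)
  also have "\<dots> = - t * (gradient f x \<bullet> d + lam \<bullet> (J x *v d) + \<mu> \<bullet> (K x *v d))"
    by (simp only: inner_scaleR_left inner_add_left inner_transpose_mult_vec)
  finally show ?thesis by (simp add: algebra_simps)
qed

text \<open>Solve the definition of \<open>d\<close> for J^T (t lam) and use that J^T is bounded
  below by \<open>sqrt C\<^sub>1\<close> in the tube; the term with t \<mu> = t w + v is controlled
  by |w| \<le> \<open>l\<^sub>g\<close>.\<close>

lemma t_lam_le:
  assumes "t \<le> T"
  shows "t * norm lam \<le> ((1 + l\<^sub>A) * (norm d + norm v) + T * (l\<^sub>f + l\<^sub>A * l\<^sub>g)) / sqrt C\<^sub>1"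
proof -
  have eq: "transpose (J x) *v (t *\<^sub>R lam) = - d - t *\<^sub>R gradient f x - transpose (K x) *v (t *\<^sub>R \<mu>)"
    unfolding d_def by (simp add: matrix_vector_mult_scaleR algebra_simps)
  have "norm (t *\<^sub>R \<mu>) \<le> T * l\<^sub>g + norm v"
  proof -
    have "norm (t *\<^sub>R \<mu>) \<le> t * norm w + norm v"
      unfolding t_\<mu> using norm_triangle_ineq[of "t *\<^sub>R w" v] t_pos by simp
    also have "t * norm w \<le> T * l\<^sub>g" using t_pos assms w_le by (intro mult_mono) auto
    finally show ?thesis by simp
  qed
  then have "l\<^sub>A * norm (t *\<^sub>R \<mu>) \<le> l\<^sub>A * (T * l\<^sub>g + norm v)"
    using l\<^sub>A_pos by (intro mult_left_mono) auto
  moreover have "norm (transpose (K x) *v (t *\<^sub>R \<mu>)) \<le> l\<^sub>A * norm (t *\<^sub>R \<mu>)"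
    by (rule jacobian_A_transpose_le[OF x_in])
  moreover have "norm (t *\<^sub>R gradient f x) \<le> T * l\<^sub>f"
    using t_pos assms gradient_f_le[OF x_in] by (auto intro: mult_mono)
  moreover have "norm (transpose (J x) *v (t *\<^sub>R lam))
      \<le> norm d + norm (t *\<^sub>R gradient f x) + norm (transpose (K x) *v (t *\<^sub>R \<mu>))"
    unfolding eq using norm_triangle_ineq4[of "- d - t *\<^sub>R gradient f x" "transpose (K x) *v (t *\<^sub>R \<mu>)"]
      norm_triangle_ineq4[of "- d" "t *\<^sub>R gradient f x"] by simp
  moreover have "sqrt C\<^sub>1 * norm (t *\<^sub>R lam) \<le> norm (transpose (J x) *v (t *\<^sub>R lam))"
    by (rule jacobian_h_transpose_lower[OF x_in])
  ultimately have "sqrt C\<^sub>1 * norm (t *\<^sub>R lam) \<le> norm d + T * l\<^sub>f + l\<^sub>A * (T * l\<^sub>g + norm v)"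
    by linarith
  also have "\<dots> \<le> (1 + l\<^sub>A) * (norm d + norm v) + T * (l\<^sub>f + l\<^sub>A * l\<^sub>g)"
    using l\<^sub>A_pos by (simp add: algebra_simps)
  finally show ?thesis using C\<^sub>1_pos t_pos by (simp add: field_simps)
qed

lemma direction_le:
  assumes T: "t \<le> T" and E: "\<Delta> \<le> E"
  shows "norm d + norm v \<le> direction_bound T E"
proof -
  define s where "s = norm d + norm v"
  define a where "a = T * (l\<^sub>f + l\<^sub>g * l\<^sub>A) + E + E * (1 + l\<^sub>A) / sqrt C\<^sub>1"
  define b where "b = E * T * (l\<^sub>f + l\<^sub>A * l\<^sub>g) / sqrt C\<^sub>1"
  have E0: "0 \<le> E" using \<Delta>_nonneg E by linarith
  have T0: "0 \<le> T" using t_pos T by linarith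
  have a: "0 \<le> a" unfolding a_def
    using E0 T0 l\<^sub>f_pos l\<^sub>g_nonneg l\<^sub>A_pos C\<^sub>1_pos by (intro add_nonneg_nonneg) auto
  have b: "0 \<le> b" unfolding b_def
    using E0 T0 l\<^sub>f_pos l\<^sub>g_nonneg l\<^sub>A_pos C\<^sub>1_pos by (intro divide_nonneg_nonneg mult_nonneg_nonneg add_nonneg_nonneg) auto
  have "t * (\<mu> \<bullet> (K x *v d)) = t * (w \<bullet> (K x *v d)) + (norm v)\<^sup>2 - v \<bullet> (v - K x *v d)"
  proof -
    have "t * (\<mu> \<bullet> (K x *v d)) = (t *\<^sub>R w + v) \<bullet> (K x *v d)" unfolding t_\<mu>[symmetric] by simp
    then show ?thesis by (simp add: inner_add_left inner_diff_right power2_norm_eq_inner)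
  qed
  \<comment> \<open>Substituting t \<mu> = t w + v in the identity for t (gradient . d) produces
    |v|^2 and leaves only pairings of bounded or nearly vanishing vectors, apart from the one with
    \<open>lam\<close>.\<close>
  then have energy: "(norm d)\<^sup>2 + (norm v)\<^sup>2
      = - (t * (gradient f x \<bullet> d)) - t * (lam \<bullet> (J x *v d)) - t * (w \<bullet> (K x *v d)) + v \<bullet> (v - K x *v d)"
    using t_inner_gradient_d by linarith
  have CS: "- (r * (p \<bullet> q)) \<le> R * (P * Q)"
    if "0 \<le> r" "r \<le> R" "norm p \<le> P" "norm q \<le> Q" for r R P Q and p q :: "'b::real_inner"
  proof -
    have "- (r * (p \<bullet> q)) = r * ((- p) \<bullet> q)" by simp
    also have "\<dots> \<le> r * (norm p * norm q)"
      using norm_cauchy_schwarz[of "- p" q] that by (intro mult_left_mono) auto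
    also have "\<dots> \<le> R * (P * Q)"
      using that by (intro mult_mono order_trans[OF norm_ge_zero \<open>norm p \<le> P\<close>]) auto
    finally show ?thesis .
  qed
  have 1: "- (t * (gradient f x \<bullet> d)) \<le> T * (l\<^sub>f * norm d)"
    using t_pos T gradient_f_le[OF x_in] by (intro CS) auto
  have 2: "- (t * (lam \<bullet> (J x *v d))) \<le> t * (norm lam * E)"
    using t_pos J_d_le E by (intro CS) auto
  have 3: "- (t * (w \<bullet> (K x *v d))) \<le> T * (l\<^sub>g * (l\<^sub>A * norm d))"
    using t_pos T w_le jacobian_A_apply_le[OF x_in] by (intro CS) auto
  have 4: "v \<bullet> (v - K x *v d) \<le> norm v * E"
    using norm_cauchy_schwarz[of v "v - K x *v d"] mult_left_mono[OF order_trans[OF v_K_d_le E], of "norm v"]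
    by simp
  \<comment> \<open>No a priori bound on \<open>lam\<close> is available, but it is paired with J d
    of size at most \<open>E\<close>, and t |lam| grows at most linearly in
    \<open>s\<close>.\<close>
  have "E * (t * norm lam) \<le> E * (((1 + l\<^sub>A) * s + T * (l\<^sub>f + l\<^sub>A * l\<^sub>g)) / sqrt C\<^sub>1)"
    unfolding s_def by (rule mult_left_mono[OF t_lam_le[OF T] E0])
  also have "\<dots> = E * (1 + l\<^sub>A) / sqrt C\<^sub>1 * s + b"
    unfolding b_def using C\<^sub>1_pos by (simp add: field_simps)
  finally have 5: "t * (norm lam * E) \<le> E * (1 + l\<^sub>A) / sqrt C\<^sub>1 * s + b" by (simp add: mult_ac)
  have "T * (l\<^sub>f + l\<^sub>g * l\<^sub>A) * norm d \<le> T * (l\<^sub>f + l\<^sub>g * l\<^sub>A) * s"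
    unfolding s_def using T0 l\<^sub>f_pos l\<^sub>g_nonneg l\<^sub>A_pos by (intro mult_left_mono) auto
  moreover have "norm v * E \<le> E * s" unfolding s_def using E0 by (simp add: algebra_simps)
  ultimately have ds: "(norm d)\<^sup>2 + (norm v)\<^sup>2 \<le> a * s + b"
    using energy 1 2 3 4 5 unfolding a_def by (simp add: algebra_simps)
  have "s\<^sup>2 \<le> 2 * ((norm d)\<^sup>2 + (norm v)\<^sup>2)"
    unfolding s_def using sum_squares_bound[of "norm d" "norm v"] by (simp add: power2_sum)
  also have "\<dots> \<le> 2 * (a * s + b)" using ds by (rule mult_left_mono) simp
  finally have s2: "s\<^sup>2 \<le> 2 * (a * s + b)" .
  \<comment> \<open>For s > 1 the constant \<open>b\<close> is at most b s, and the quadratic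
    inequality can be divided by \<open>s\<close>.\<close>
  have "s \<le> 1 + 2 * (a + b)"
  proof (cases "s \<le> 1")
    case False
    then have "b \<le> b * s" using mult_left_mono[of 1 s b] b by simp
    then have "s * s \<le> (2 * (a + b)) * s" using s2 by (simp add: power2_eq_square algebra_simps)
    then have "s \<le> 2 * (a + b)" using False by simp
    then show ?thesis by simp
  qed (use a b in simp)
  then show ?thesis unfolding direction_bound_def s_def a_def b_def by (simp add: algebra_simps)
qed

lemma multipliers_le:
  assumes T: "t \<le> T" and E: "\<Delta> \<le> E" and T\<^sub>0: "0 < T\<^sub>0" "T\<^sub>0 \<le> t"
  shows "norm lam + norm \<mu> \<le> multiplier_bound T\<^sub>0 T E"
proof -
  let ?D = "direction_bound T E"
  let ?R = "((1 + l\<^sub>A) * ?D + T * (l\<^sub>f + l\<^sub>A * l\<^sub>g)) / sqrt C\<^sub>1"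
  note D = direction_le[OF T E]
  have "t * norm lam \<le> ((1 + l\<^sub>A) * (norm d + norm v) + T * (l\<^sub>f + l\<^sub>A * l\<^sub>g)) / sqrt C\<^sub>1"
    by (rule t_lam_le[OF T])
  also have "\<dots> \<le> ?R"
    using D l\<^sub>A_pos C\<^sub>1_pos by (intro divide_right_mono add_right_mono mult_left_mono) auto
  finally have "t * norm lam \<le> ?R" .
  moreover have "T\<^sub>0 * norm lam \<le> t * norm lam" using T\<^sub>0 by (intro mult_right_mono) auto
  ultimately have "norm lam \<le> ?R / T\<^sub>0"
    using T\<^sub>0 by (subst pos_le_divide_eq) (simp_all add: mult.commute)
  moreover have "norm \<mu> \<le> l\<^sub>g + ?D / T\<^sub>0"
  proof -
    have "norm \<mu> = norm (w + v /\<^sub>R t)" by (simp add: w_def)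
    also have "\<dots> \<le> norm w + norm v / t"
      using norm_triangle_ineq[of w "v /\<^sub>R t"] t_pos by (simp add: divide_inverse mult.commute)
    also have "norm v / t \<le> ?D / T\<^sub>0"
      using D T\<^sub>0 by (intro frac_le) (auto intro: order_trans[OF _ D])
    finally show ?thesis using w_le by linarith
  qed
  ultimately show ?thesis unfolding multiplier_bound_def by linarith
qed

text \<open>Since \<open>d\<close> is tangent up to \<Delta>, \<open>h\<close> changes only by
  \<eta> \<Delta> and a second-order term. The reverse form later recovers |h x| from the acceptance
  test, which sees \<open>h\<close> at the trial base point only.\<close>

lemma
  assumes "0 \<le> \<eta>"
  shows h_step: "norm (h (x + \<eta> *\<^sub>R d)) \<le> norm (h x) + \<eta> * \<Delta> + L\<^sub>h * (\<eta>\<^sup>2 * (norm d)\<^sup>2)"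
    and h_step_rev: "norm (h x) \<le> norm (h (x + \<eta> *\<^sub>R d)) + \<eta> * \<Delta> + L\<^sub>h * (\<eta>\<^sup>2 * (norm d)\<^sup>2)"
proof -
  let ?y = "x + \<eta> *\<^sub>R d"
  have "norm (h ?y - h x - \<eta> *\<^sub>R (J x *v d)) \<le> L\<^sub>h * (\<eta>\<^sup>2 * (norm d)\<^sup>2)"
    using h_taylor[of ?y x] by (simp add: matrix_vector_mult_scaleR power_mult_distrib)
  moreover have "norm (\<eta> *\<^sub>R (J x *v d)) \<le> \<eta> * \<Delta>"
    using assms J_d_le by (simp add: mult_left_mono)
  ultimately have *: "norm (h ?y - h x) \<le> \<eta> * \<Delta> + L\<^sub>h * (\<eta>\<^sup>2 * (norm d)\<^sup>2)"
    using norm_triangle_sub[of "h ?y - h x" "\<eta> *\<^sub>R (J x *v d)"] by linarith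
  show "norm (h ?y) \<le> norm (h x) + \<eta> * \<Delta> + L\<^sub>h * (\<eta>\<^sup>2 * (norm d)\<^sup>2)"
    using * norm_triangle_sub[of "h ?y" "h x"] by linarith
  show "norm (h x) \<le> norm (h ?y) + \<eta> * \<Delta> + L\<^sub>h * (\<eta>\<^sup>2 * (norm d)\<^sup>2)"
    using * norm_triangle_sub[of "h x" "h ?y"] by (simp add: norm_minus_commute)
qed

text \<open>With w . v = \<mu> . v - |v|^2 / t and the formula for the gradient term, both
  multipliers end up paired with the residuals J d and v - K d, of size at most \<Delta>.\<close>

lemma model_decrease:
  "gradient f x \<bullet> d + w \<bullet> v \<le> - ((norm d)\<^sup>2 + (norm v)\<^sup>2) / t + (norm lam + norm \<mu>) * \<Delta>"
proof -
  have "- (lam \<bullet> (J x *v d)) \<le> norm lam * \<Delta>"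
    using norm_cauchy_schwarz[of "- lam" "J x *v d"] mult_left_mono[OF J_d_le, of "norm lam"] by simp
  moreover have "\<mu> \<bullet> (v - K x *v d) \<le> norm \<mu> * \<Delta>"
    using norm_cauchy_schwarz[of \<mu> "v - K x *v d"] mult_left_mono[OF v_K_d_le, of "norm \<mu>"] by simp
  moreover have "gradient f x \<bullet> d + w \<bullet> v
      = - ((norm d)\<^sup>2 + (norm v)\<^sup>2) / t - lam \<bullet> (J x *v d) + \<mu> \<bullet> (v - K x *v d)"
  proof -
    have "gradient f x \<bullet> d = - (norm d)\<^sup>2 / t - lam \<bullet> (J x *v d) - \<mu> \<bullet> (K x *v d)"
      using t_inner_gradient_d t_pos by (simp add: field_simps)
    moreover have "w \<bullet> v = \<mu> \<bullet> v - (norm v)\<^sup>2 / t"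
      unfolding w_def inner_diff_left power2_norm_eq_inner by (simp add: divide_inverse mult.commute)
    ultimately show ?thesis by (simp add: inner_diff_right diff_divide_distrib)
  qed
  ultimately show ?thesis by (simp add: distrib_right)
qed

text \<open>Convexity bounds \<open>g\<close> between A x and A x + K d, replacing K d by
  \<open>v\<close> costs \<open>l\<^sub>g\<close> \<Delta>, and the subgradient \<open>w\<close> at
  A x + v gives g (A x + v) \<le> g (A x) + w . v, so \<open>model_decrease\<close> applies. The
  Taylor remainders form the last term.\<close>

lemma merit_step:
  assumes \<eta>: "0 \<le> \<eta>" "\<eta> \<le> 1" and \<alpha>: "0 \<le> \<alpha>"
  shows "merit f g A h \<alpha> (x + \<eta> *\<^sub>R d) \<le> merit f g A h \<alpha> x - \<eta> / t * ((norm d)\<^sup>2 + (norm v)\<^sup>2)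
    + \<eta> * (\<alpha> + l\<^sub>g + norm lam + norm \<mu>) * \<Delta> + (L\<^sub>f + l\<^sub>g * \<bar>L\<^sub>A\<bar> + \<alpha> * L\<^sub>h) * (\<eta>\<^sup>2 * (norm d)\<^sup>2)"
proof -
  let ?y = "x + \<eta> *\<^sub>R d" and ?q = "\<eta>\<^sup>2 * (norm d)\<^sup>2"
  have f: "f ?y \<le> f x + \<eta> * (gradient f x \<bullet> d) + L\<^sub>f * ?q"
    using f_taylor[of ?y x] by (simp add: power_mult_distrib inner_commute)
  have "g (A ?y) \<le> g (A x + \<eta> *\<^sub>R (K x *v d)) + l\<^sub>g * (\<bar>L\<^sub>A\<bar> * ?q)"
  proof -
    have "norm (A ?y - (A x + \<eta> *\<^sub>R (K x *v d))) \<le> \<bar>L\<^sub>A\<bar> * ?q"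
      using A_taylor[of ?y x] by (simp add: power_mult_distrib matrix_vector_mult_scaleR diff_diff_eq)
    then have "l\<^sub>g * norm (A ?y - (A x + \<eta> *\<^sub>R (K x *v d))) \<le> l\<^sub>g * (\<bar>L\<^sub>A\<bar> * ?q)"
      using l\<^sub>g_nonneg by (rule mult_left_mono)
    then show ?thesis
      using lipschitz_onD[OF g_lipschitz, of "A ?y" "A x + \<eta> *\<^sub>R (K x *v d)"] by (simp add: dist_norm)
  qed
  also have "g (A x + \<eta> *\<^sub>R (K x *v d)) \<le> (1 - \<eta>) * g (A x) + \<eta> * g (A x + K x *v d)"
    using convex_onD[OF convex_g, of \<eta> "A x" "A x + K x *v d"] \<eta> by (simp add: algebra_simps)
  also have "\<eta> * g (A x + K x *v d) \<le> \<eta> * (g (A x) + w \<bullet> v + l\<^sub>g * \<Delta>)"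
  proof (rule mult_left_mono)
    have "l\<^sub>g * norm (v - K x *v d) \<le> l\<^sub>g * \<Delta>" using l\<^sub>g_nonneg v_K_d_le by (intro mult_left_mono)
    then have "g (A x + K x *v d) \<le> g (A x + v) + l\<^sub>g * \<Delta>"
      using lipschitz_onD[OF g_lipschitz, of "A x + v" "A x + K x *v d"] by (simp add: dist_norm)
    moreover have "g (A x + v) + w \<bullet> (A x - (A x + v)) \<le> g (A x)"
      using w_subgradient unfolding subdifferential_def by blast
    ultimately show "g (A x + K x *v d) \<le> g (A x) + w \<bullet> v + l\<^sub>g * \<Delta>" by simp
  qed (rule \<eta>)
  finally have g: "g (A ?y) \<le> g (A x) + \<eta> * (w \<bullet> v) + \<eta> * l\<^sub>g * \<Delta> + l\<^sub>g * \<bar>L\<^sub>A\<bar> * ?q"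
    by (simp add: algebra_simps)
  have h: "\<alpha> * norm (h ?y) \<le> \<alpha> * (norm (h x) + \<eta> * \<Delta> + L\<^sub>h * ?q)"
    by (rule mult_left_mono[OF h_step[OF \<eta>(1)] \<alpha>])
  have "\<eta> * (gradient f x \<bullet> d + w \<bullet> v)
      \<le> \<eta> * (- ((norm d)\<^sup>2 + (norm v)\<^sup>2) / t + (norm lam + norm \<mu>) * \<Delta>)"
    by (rule mult_left_mono[OF model_decrease \<eta>(1)])
  then show ?thesis
    using f g h unfolding merit_def by (simp add: algebra_simps add_divide_distrib diff_divide_distrib)
qed

text \<open>The witnesses tested in \<open>eps_stationary\<close> are \<open>v\<close> and
  \<open>lam\<close>; with the subgradient \<open>w\<close> the residual vector is -(d + K^T
  v)/t.\<close>

lemma not_eps_stationary: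
  assumes "\<not> eps_stationary f g A h \<epsilon> x"
  shows "\<epsilon> \<le> (norm d + l\<^sub>A * norm v) / t \<or> \<epsilon> \<le> norm v \<or> \<epsilon> \<le> norm (h x)"
proof -
  let ?r = "gradient f x + transpose (K x) *v w + transpose (J x) *v lam"
  let ?S = "{gradient f x + transpose (K x) *v w + transpose (J x) *v lam | w.
               w \<in> subdifferential g (A x + v)}"
  have "?r \<in> ?S" using w_subgradient by blast
  then have "infdist 0 ?S \<le> dist 0 ?r" by (rule infdist_le)
  also have "dist 0 ?r = norm (- (d + transpose (K x) *v v) /\<^sub>R t)"
  proof -
    have "?r = (gradient f x + transpose (J x) *v lam + transpose (K x) *v \<mu>) - transpose (K x) *v v /\<^sub>R t"
      unfolding w_def by (simp add: matrix_vector_mult_diff_distrib matrix_vector_mult_scaleR)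
    also have "\<dots> = - (d + transpose (K x) *v v) /\<^sub>R t"
      using t_pos unfolding d_def by (simp add: scaleR_add_right scaleR_diff_right)
    finally show ?thesis by (simp only: dist_0_norm)
  qed
  also have "\<dots> \<le> (norm d + l\<^sub>A * norm v) / t"
  proof -
    have "norm (d + transpose (K x) *v v) \<le> norm d + l\<^sub>A * norm v"
      using norm_triangle_ineq[of d "transpose (K x) *v v"] jacobian_A_transpose_le[OF x_in, of v] by linarith
    then have "norm (d + transpose (K x) *v v) / t \<le> (norm d + l\<^sub>A * norm v) / t"
      using t_pos by (intro divide_right_mono) auto
    then show ?thesis
      using t_pos by (simp add: divide_inverse mult.commute[of "inverse t"] del: minus_add_distrib)
  qed
  finally have "infdist 0 ?S \<le> (norm d + l\<^sub>A * norm v) / t" .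
  moreover have "\<not> Max {infdist 0 ?S, norm v, norm (h x)} < \<epsilon>"
    using assms unfolding eps_stationary_def by blast
  then have "\<epsilon> \<le> infdist 0 ?S \<or> \<epsilon> \<le> norm v \<or> \<epsilon> \<le> norm (h x)"
    by (subst (asm) Max_less_iff) auto
  ultimately show ?thesis by linarith
qed

end

subsection \<open>Acceptance of small steps\<close>

text \<open>The index \<open>i\<close> counts the rejections so far. At index \<open>n\<close> every
  trial point is acceptable, so a rejection there is impossible and the loop ends by then.\<close>

lemma backtrack_bounded:
  assumes bt: "backtrack \<gamma> trial ok \<eta> \<tau> z"
    and ok: "\<And>z. trial (\<gamma> ^ n * \<eta>\<^sub>0) ((\<gamma> / 2) ^ n * \<tau>\<^sub>0) z \<Longrightarrow> ok (\<gamma> ^ n * \<eta>\<^sub>0) ((\<gamma> / 2) ^ n * \<tau>\<^sub>0) z"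
    and start: "\<eta> = \<gamma> ^ i * \<eta>\<^sub>0" "\<tau> = (\<gamma> / 2) ^ i * \<tau>\<^sub>0" "i \<le> n"
  shows "\<exists>j\<le>n. trial (\<gamma> ^ j * \<eta>\<^sub>0) ((\<gamma> / 2) ^ j * \<tau>\<^sub>0) z \<and> ok (\<gamma> ^ j * \<eta>\<^sub>0) ((\<gamma> / 2) ^ j * \<tau>\<^sub>0) z"
  using bt start
proof (induction arbitrary: i)
  case (accept \<eta> \<tau> z)
  then show ?case by blast
next
  case (reject \<eta> \<tau> z' z)
  have "i \<noteq> n" using reject ok by blast
  then have "Suc i \<le> n" using reject by simp
  then show ?case using reject.IH[of "Suc i"] reject.prems by (simp add: mult.assoc)
qed

lemma nat_le_max_of_reciprocal_bound:
  fixes S \<epsilon> :: real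
  assumes S: "0 \<le> S" and \<epsilon>: "0 < \<epsilon>" and n: "real n \<le> S * (1 / \<epsilon>\<^sup>2 + 1 / \<epsilon>)"
  shows "real n \<le> max (2 * S / \<epsilon>\<^sup>2) (2 * S / \<epsilon>)"
  using n by (simp add: max_def field_simps split: if_splits) (use S \<epsilon> in argo)

context fsipl_problem
begin

lemma in_tube_if_small: "norm (h z) \<le> \<theta> / \<kappa> \<Longrightarrow> z \<in> tube M \<theta>"
  using error_bound[of z] \<kappa>_pos unfolding tube_def by (simp add: field_simps)

text \<open>The step gives |h z| \<le> (1 - \<tau> \<open>C\<^sub>1\<close> + \<tau>^2 c) |h y|. In
  \<open>c\<close> the first summand comes from the linear part of the step, the second from the
  Taylor remainder with |h y| \<le> \<theta>/\<kappa>. The gain in the penalty beats the change of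
  \<open>F\<close>, which is linear in \<tau> |h y| too.\<close>

lemma correction_descent:
  assumes small: "norm (h y) \<le> \<theta> / \<kappa>"
    and z: "z = y - \<tau> *\<^sub>R gradient (infeas h) y"
    and \<tau>: "0 < \<tau>" "\<tau> * C\<^sub>2 \<le> 1" "\<tau> * sqrt C\<^sub>2 \<le> \<kappa>"
    and c: "c = C\<^sub>1 * C\<^sub>2 / 2 + L\<^sub>h * C\<^sub>2 * (\<theta> / \<kappa>)" "\<tau> * c \<le> C\<^sub>1"
    and \<alpha>: "0 \<le> \<alpha>" "\<tau> * (\<alpha> * c + \<sigma> / 2) \<le> \<alpha> * C\<^sub>1 - sqrt C\<^sub>2 * (l\<^sub>f + l\<^sub>g * l\<^sub>A)"
  shows "norm (h z) \<le> norm (h y)"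
    and "merit f g A h \<alpha> z \<le> merit f g A h \<alpha> y - \<sigma> / 2 * (\<tau>\<^sup>2 * norm (h y))"
proof -
  let ?u = "h y" and ?n = "norm (h y)"
  have y: "y \<in> tube M \<theta>" by (rule in_tube_if_small[OF small])
  note y2 = tube_mono[OF y]
  define p where "p = transpose (J y) *v ?u"
  have zy: "z - y = - \<tau> *\<^sub>R p"
    unfolding z p_def gradient_infeas[OF h_has_derivative] by simp
  have p: "norm p \<le> sqrt C\<^sub>2 * ?n" unfolding p_def by (rule jacobian_h_transpose_upper[OF y2])
  have "\<tau> * norm p \<le> \<tau> * (sqrt C\<^sub>2 * ?n)" using p \<tau>(1) by (intro mult_left_mono) auto
  then have nzy: "norm (z - y) \<le> \<tau> * sqrt C\<^sub>2 * ?n" unfolding zy using \<tau>(1) by simp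
  have "norm (?u - \<tau> *\<^sub>R (J y *v p)) \<le> (1 - \<tau> * C\<^sub>1 + \<tau>\<^sup>2 * (C\<^sub>1 * C\<^sub>2 / 2)) * ?n"
  proof (rule power2_le_imp_le)
    let ?a = "\<tau> * C\<^sub>1" and ?b = "\<tau>\<^sup>2 * (C\<^sub>1 * C\<^sub>2 / 2)"
    have up: "?u \<bullet> (J y *v p) = (norm p)\<^sup>2"
      unfolding p_def inner_transpose_mult_vec[symmetric] power2_norm_eq_inner ..
    have Jp: "(norm (J y *v p))\<^sup>2 \<le> C\<^sub>2 * (norm p)\<^sup>2"
      using power_mono[OF jacobian_h_upper[OF y2, of p] norm_ge_zero, of 2] C\<^sub>2_pos
      by (simp add: power_mult_distrib)
    have lower: "C\<^sub>1 * ?n\<^sup>2 \<le> (norm p)\<^sup>2"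
      using power_mono[OF jacobian_h_transpose_lower[OF y2, of ?u], of 2] C\<^sub>1_pos
      by (simp add: power_mult_distrib p_def)
    have "(norm (?u - \<tau> *\<^sub>R (J y *v p)))\<^sup>2 = ?n\<^sup>2 - 2 * \<tau> * (norm p)\<^sup>2 + \<tau>\<^sup>2 * (norm (J y *v p))\<^sup>2"
      unfolding up[symmetric] power2_norm_eq_inner[of "?u - _"] power2_norm_eq_inner[of ?u]
        power2_norm_eq_inner[of "J y *v p"]
      by (simp add: inner_diff_left inner_diff_right inner_commute[of "J y *v p" ?u] power2_eq_square algebra_simps)
    also have "\<dots> \<le> ?n\<^sup>2 - 2 * \<tau> * (norm p)\<^sup>2 + \<tau>\<^sup>2 * (C\<^sub>2 * (norm p)\<^sup>2)"
      using Jp by (intro add_left_mono mult_left_mono) auto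
    also have "\<dots> = ?n\<^sup>2 - \<tau> * (2 - \<tau> * C\<^sub>2) * (norm p)\<^sup>2" by (simp add: power2_eq_square algebra_simps)
    also have "\<dots> \<le> ?n\<^sup>2 - \<tau> * (2 - \<tau> * C\<^sub>2) * (C\<^sub>1 * ?n\<^sup>2)"
      using \<tau> lower by (intro diff_left_mono mult_left_mono mult_nonneg_nonneg) auto
    also have "\<dots> = (1 + 2 * (?b - ?a)) * ?n\<^sup>2" by (simp add: power2_eq_square algebra_simps)
    \<comment> \<open>This is 1 + 2r \<le> (1 + r)^2 with r = ?b - ?a, which allows the square root
      to be taken.\<close>
    also have "\<dots> \<le> (1 - ?a + ?b)\<^sup>2 * ?n\<^sup>2"
      using sum_power2_ge_zero[of "?b - ?a" 0]
      by (intro mult_right_mono) (auto simp: power2_eq_square algebra_simps)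
    finally show "(norm (?u - \<tau> *\<^sub>R (J y *v p)))\<^sup>2 \<le> ((1 - ?a + ?b) * ?n)\<^sup>2"
      by (simp only: power_mult_distrib)
    have "?a \<le> \<tau> * C\<^sub>2" using \<tau>(1) C\<^sub>1_le_C\<^sub>2 by simp
    then have "?a \<le> 1" using \<tau>(2) by linarith
    then show "0 \<le> (1 - ?a + ?b) * ?n" using \<tau> C\<^sub>1_pos C\<^sub>2_pos by (intro mult_nonneg_nonneg add_nonneg_nonneg) auto
  qed
  moreover have "norm (h z - (?u - \<tau> *\<^sub>R (J y *v p))) \<le> L\<^sub>h * (norm (z - y))\<^sup>2"
  proof -
    have "J y *v (z - y) = - \<tau> *\<^sub>R (J y *v p)" unfolding zy by (rule matrix_vector_mult_scaleR)
    then have "h z - (?u - \<tau> *\<^sub>R (J y *v p)) = h z - ?u - J y *v (z - y)" by (simp only:) simp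
    then show ?thesis using h_taylor[of z y] by (simp only:)
  qed
  moreover have "L\<^sub>h * (norm (z - y))\<^sup>2 \<le> \<tau>\<^sup>2 * (L\<^sub>h * C\<^sub>2 * (\<theta> / \<kappa>)) * ?n"
  proof -
    have "(norm (z - y))\<^sup>2 \<le> (\<tau> * sqrt C\<^sub>2 * ?n)\<^sup>2" using nzy by (rule power_mono) simp
    also have "\<dots> = \<tau>\<^sup>2 * C\<^sub>2 * (?n * ?n)" using C\<^sub>2_pos by (simp add: power_mult_distrib power2_eq_square)
    also have "\<dots> \<le> \<tau>\<^sup>2 * C\<^sub>2 * (\<theta> / \<kappa> * ?n)"
      using small C\<^sub>2_pos by (intro mult_left_mono mult_right_mono) auto
    finally have "L\<^sub>h * (norm (z - y))\<^sup>2 \<le> L\<^sub>h * (\<tau>\<^sup>2 * C\<^sub>2 * (\<theta> / \<kappa> * ?n))"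
      using L\<^sub>h_pos by (intro mult_left_mono) auto
    then show ?thesis by (simp add: mult_ac)
  qed
  ultimately have "norm (h z) \<le> (1 - \<tau> * C\<^sub>1 + \<tau>\<^sup>2 * (C\<^sub>1 * C\<^sub>2 / 2)) * ?n + \<tau>\<^sup>2 * (L\<^sub>h * C\<^sub>2 * (\<theta> / \<kappa>)) * ?n"
    using norm_triangle_sub[of "h z" "?u - \<tau> *\<^sub>R (J y *v p)"] by linarith
  also have "\<dots> = ?n - \<tau> * (C\<^sub>1 - \<tau> * c) * ?n"
    unfolding c(1) by (simp add: power2_eq_square algebra_simps)
  finally have hz: "norm (h z) \<le> ?n - \<tau> * (C\<^sub>1 - \<tau> * c) * ?n" .
  moreover have "0 \<le> \<tau> * (C\<^sub>1 - \<tau> * c) * ?n" using \<tau>(1) c(2) by (intro mult_nonneg_nonneg) auto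
  ultimately show "norm (h z) \<le> ?n" by linarith
  \<comment> \<open>The step has length at most \<tau> \<open>sqrt C\<^sub>2\<close> |h y| \<le>
    \<theta>, so from the \<theta>-tube it stays in the 2\<theta>-tube; this is where \<tau>
    \<open>sqrt C\<^sub>2\<close> \<le> \<kappa> enters.\<close>
  have seg: "closed_segment y z \<subseteq> tube M (2 * \<theta>)"
  proof
    fix q assume "q \<in> closed_segment y z"
    then have "norm (q - y) \<le> norm (z - y)" by (rule segment_bound1)
    also have "\<dots> \<le> \<tau> * sqrt C\<^sub>2 * ?n" by (rule nzy)
    also have "\<dots> \<le> \<kappa> * (\<theta> / \<kappa>)" using \<tau> small \<kappa>_pos by (intro mult_mono) auto
    finally have "dist q y \<le> \<theta>" using \<kappa>_pos by (simp add: dist_norm)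
    moreover have "infdist q M \<le> infdist y M + dist q y" by (rule infdist_triangle)
    ultimately show "q \<in> tube M (2 * \<theta>)" using y unfolding tube_def by simp
  qed
  have "F z \<le> F y + (l\<^sub>f + l\<^sub>g * l\<^sub>A) * norm (z - y)"
    using F_lipschitz_on_segment[OF seg] by linarith
  also have "(l\<^sub>f + l\<^sub>g * l\<^sub>A) * norm (z - y) \<le> (l\<^sub>f + l\<^sub>g * l\<^sub>A) * (\<tau> * sqrt C\<^sub>2 * ?n)"
    using nzy l\<^sub>f_pos l\<^sub>g_nonneg l\<^sub>A_pos by (intro mult_left_mono) auto
  finally have "merit f g A h \<alpha> z
      \<le> F y + (l\<^sub>f + l\<^sub>g * l\<^sub>A) * (\<tau> * sqrt C\<^sub>2 * ?n) + \<alpha> * (?n - \<tau> * (C\<^sub>1 - \<tau> * c) * ?n)"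
    unfolding merit_def using mult_left_mono[OF hz \<alpha>(1)] by linarith
  also have "\<dots> = merit f g A h \<alpha> y - \<sigma> / 2 * (\<tau>\<^sup>2 * ?n)
      + (\<tau> * (\<alpha> * c + \<sigma> / 2) - (\<alpha> * C\<^sub>1 - sqrt C\<^sub>2 * (l\<^sub>f + l\<^sub>g * l\<^sub>A))) * (\<tau> * ?n)"
    unfolding merit_def by (simp add: power2_eq_square algebra_simps)
  also have "\<dots> \<le> merit f g A h \<alpha> y - \<sigma> / 2 * (\<tau>\<^sup>2 * ?n) + 0"
    using \<alpha>(2) \<tau>(1) by (intro add_left_mono mult_nonpos_nonneg) auto
  finally show "merit f g A h \<alpha> z \<le> merit f g A h \<alpha> y - \<sigma> / 2 * (\<tau>\<^sup>2 * ?n)" by simp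
qed

text \<open>By the error bound the projection moves at most \<kappa> |h y|, which limits the growth
  of \<open>F\<close>, while the penalty drops from \<alpha> |h y| to 0. Each point of the segment
  is at least as close to \<open>z\<close> in \<open>M\<close> as \<open>y\<close> is, so the
  segment stays in the tube.\<close>

lemma projection_descent:
  assumes y: "y \<in> tube M (2 * \<theta>)" and z: "z \<in> M" "dist y z = infdist y M"
    and \<alpha>: "\<kappa> * (l\<^sub>f + l\<^sub>g * l\<^sub>A) + b \<le> \<alpha>"
  shows "merit f g A h \<alpha> z \<le> merit f g A h \<alpha> y - b * norm (h y)"
proof -
  have hz: "h z = 0" using z(1) M_eq by blast
  have seg: "closed_segment y z \<subseteq> tube M (2 * \<theta>)"
  proof
    fix q assume "q \<in> closed_segment y z"
    then have "dist q z \<le> dist y z" by (simp add: segment_bound(2) dist_norm norm_minus_commute[of y])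
    moreover have "infdist q M \<le> dist q z" by (rule infdist_le[OF z(1)])
    ultimately show "q \<in> tube M (2 * \<theta>)" using y z(2) unfolding tube_def by simp
  qed
  have "F z \<le> F y + (l\<^sub>f + l\<^sub>g * l\<^sub>A) * norm (z - y)"
    using F_lipschitz_on_segment[OF seg] by linarith
  also have "norm (z - y) \<le> \<kappa> * norm (h y)"
    using z(2) error_bound[of y] by (simp add: dist_norm norm_minus_commute)
  then have "(l\<^sub>f + l\<^sub>g * l\<^sub>A) * norm (z - y) \<le> (l\<^sub>f + l\<^sub>g * l\<^sub>A) * (\<kappa> * norm (h y))"
    using l\<^sub>f_pos l\<^sub>g_nonneg l\<^sub>A_pos by (intro mult_left_mono) auto
  also have "\<dots> \<le> (\<alpha> - b) * norm (h y)"
    using mult_right_mono[OF \<alpha>, of "norm (h y)"] by (simp add: algebra_simps)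
  finally show ?thesis unfolding merit_def hz by (simp add: algebra_simps)
qed

end

context fsipl_direction
begin

text \<open>The descent along \<open>d\<close> is followed by the descent of whichever correction
  applies; \<eta> |d| \<le> \<theta> keeps the intermediate point in the 2\<theta>-tube.\<close>

lemma step_accepted:
  assumes \<eta>: "0 < \<eta>" "\<eta> \<le> 1" "\<eta> * norm d \<le> \<theta>"
      "\<eta> * (L\<^sub>f + l\<^sub>g * \<bar>L\<^sub>A\<bar> + \<alpha> * L\<^sub>h + \<sigma> / 2) \<le> 1 / t"
    and \<tau>: "0 < \<tau>" "\<tau> * C\<^sub>2 \<le> 1" "\<tau> * sqrt C\<^sub>2 \<le> \<kappa>"
    and c: "c = C\<^sub>1 * C\<^sub>2 / 2 + L\<^sub>h * C\<^sub>2 * (\<theta> / \<kappa>)" "\<tau> * c \<le> C\<^sub>1"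
    and \<alpha>: "0 \<le> \<alpha>" "\<tau> * (\<alpha> * c + \<sigma> / 2) \<le> \<alpha> * C\<^sub>1 - sqrt C\<^sub>2 * (l\<^sub>f + l\<^sub>g * l\<^sub>A)"
      "\<kappa> * (l\<^sub>f + l\<^sub>g * l\<^sub>A) + \<sigma> * \<tau>\<^sup>2 / 2 \<le> \<alpha>"
    and \<rho>: "0 \<le> \<rho>"
    and z: "correction_step h M \<theta> \<kappa> \<tau> (x + \<eta> *\<^sub>R d) z"
  shows "norm (h z) \<le> \<theta> / \<kappa>"
    and "merit f g A h \<alpha> z \<le> merit f g A h \<alpha> x
      - \<sigma> / 2 * (\<eta>\<^sup>2 * (norm d)\<^sup>2 + \<tau>\<^sup>2 * norm (h (x + \<eta> *\<^sub>R d))) - \<eta> / (2 * t) * (norm v)\<^sup>2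
      + \<eta> * (\<alpha> + l\<^sub>g + norm lam + norm \<mu>) * \<Delta> + \<rho>"
proof -
  let ?y = "x + \<eta> *\<^sub>R d"
  have "infdist ?y M \<le> infdist x M + dist ?y x" by (rule infdist_triangle)
  then have y: "?y \<in> tube M (2 * \<theta>)"
    using x_in_tube \<eta> unfolding tube_def by (simp add: dist_norm)
  have cases: "norm (h z) \<le> \<theta> / \<kappa> \<and> merit f g A h \<alpha> z \<le> merit f g A h \<alpha> ?y - \<sigma> / 2 * (\<tau>\<^sup>2 * norm (h ?y))"
  proof (cases "norm (h ?y) \<le> \<theta> / \<kappa>")
    case True
    then have "z = ?y - \<tau> *\<^sub>R gradient (infeas h) ?y" using z unfolding correction_step_def by simp
    from correction_descent[OF True this \<tau> c \<alpha>(1,2)] True show ?thesis by linarith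
  next
    case False
    then have z: "z \<in> M" "dist ?y z = infdist ?y M" using z unfolding correction_step_def by simp_all
    then have "h z = 0" using M_eq by blast
    then show ?thesis
      using projection_descent[OF y z \<alpha>(3)] \<theta>_pos \<kappa>_pos by (simp add: algebra_simps)
  qed
  then show "norm (h z) \<le> \<theta> / \<kappa>" by blast
  \<comment> \<open>The first-order decrease in |d|^2 absorbs both the Taylor remainders and the
    \<sigma>/2 term of the test; for |v|^2 the test asks for only half of what is available.\<close>
  have "\<eta> * (L\<^sub>f + l\<^sub>g * \<bar>L\<^sub>A\<bar> + \<alpha> * L\<^sub>h + \<sigma> / 2) * (\<eta> * (norm d)\<^sup>2) \<le> 1 / t * (\<eta> * (norm d)\<^sup>2)"
    using \<eta> by (intro mult_right_mono) auto
  then have "(L\<^sub>f + l\<^sub>g * \<bar>L\<^sub>A\<bar> + \<alpha> * L\<^sub>h) * (\<eta>\<^sup>2 * (norm d)\<^sup>2) + \<sigma> / 2 * (\<eta>\<^sup>2 * (norm d)\<^sup>2) \<le> \<eta> / t * (norm d)\<^sup>2"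
    by (simp add: power2_eq_square algebra_simps)
  moreover have "\<eta> / (2 * t) * (norm v)\<^sup>2 \<le> \<eta> / t * (norm v)\<^sup>2"
    using \<eta> t_pos by (intro mult_right_mono) (auto simp: field_simps)
  ultimately show "merit f g A h \<alpha> z \<le> merit f g A h \<alpha> x
      - \<sigma> / 2 * (\<eta>\<^sup>2 * (norm d)\<^sup>2 + \<tau>\<^sup>2 * norm (h (x + \<eta> *\<^sub>R d))) - \<eta> / (2 * t) * (norm v)\<^sup>2
      + \<eta> * (\<alpha> + l\<^sub>g + norm lam + norm \<mu>) * \<Delta> + \<rho>"
    using cases merit_step[of \<eta> \<alpha>] \<eta> \<alpha>(1) \<rho> unfolding distrib_left[of "\<sigma> / 2"] distrib_left[of "\<eta> / t"]
    by linarith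
qed

end

subsection \<open>Complexity bound\<close>

context fsipl_problem
begin

text \<open>\<open>C\<close> and \<open>E\<close> are chosen before the iterate, which makes the
  estimate summable over all iterations. The factor 1/\<epsilon>^2 + 1/\<epsilon> covers both ways
  of failing stationarity: a large direction enters squared, a large infeasibility linearly.\<close>

lemma fsipl_step_progress:
  fixes \<alpha> \<sigma> \<gamma> \<eta>\<^sub>0 \<tau>\<^sub>0 T\<^sub>0 T \<Delta>\<^sub>0 \<tau>' :: real
  assumes \<gamma>: "0 < \<gamma>" "\<gamma> < 1" and pos: "0 < \<eta>\<^sub>0" "0 < \<tau>\<^sub>0" "0 < \<sigma>" "0 < T\<^sub>0" "0 < \<tau>'"
    and T: "T\<^sub>0 \<le> T" and \<alpha>: "0 < \<alpha>" "sqrt C\<^sub>2 * (l\<^sub>f + l\<^sub>g * l\<^sub>A) < \<alpha> * C\<^sub>1"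
      "\<kappa> * (l\<^sub>f + l\<^sub>g * l\<^sub>A) + \<sigma> * \<tau>'\<^sup>2 / 2 \<le> \<alpha>"
  obtains C E where "0 < C" "0 \<le> E"
    "\<And>t \<Delta> \<rho> x x'. \<lbrakk>t \<in> {T\<^sub>0..T}; \<Delta> \<in> {0..\<Delta>\<^sub>0}; 0 \<le> \<rho>; norm (h x) \<le> \<theta> / \<kappa>;
        fsipl_step f g A h M \<theta> \<kappa> l\<^sub>g \<gamma> \<alpha> \<eta>\<^sub>0 \<tau>\<^sub>0 \<sigma> t \<Delta> \<rho> x x'\<rbrakk> \<Longrightarrow>
      norm (h x') \<le> \<theta> / \<kappa> \<and>
      (\<forall>\<epsilon>>0. \<not> eps_stationary f g A h \<epsilon> x \<longrightarrow>
        1 \<le> C * (merit f g A h \<alpha> x - merit f g A h \<alpha> x' + E * \<Delta> + \<rho>) * (1 / \<epsilon>\<^sup>2 + 1 / \<epsilon>))"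
proof -
  \<comment> \<open>The absolute value and the added 1 make \<open>D\<close> a positive divisor
    whatever the sign of the bound.\<close>
  define D where "D = \<bar>direction_bound T \<Delta>\<^sub>0\<bar> + 1"
  define B where "B = \<bar>multiplier_bound T\<^sub>0 T \<Delta>\<^sub>0\<bar>"
  define c where "c = C\<^sub>1 * C\<^sub>2 / 2 + L\<^sub>h * C\<^sub>2 * (\<theta> / \<kappa>)"
  define Q where "Q = L\<^sub>f + l\<^sub>g * \<bar>L\<^sub>A\<bar> + \<alpha> * L\<^sub>h + \<sigma> / 2"
  define gap where "gap = \<alpha> * C\<^sub>1 - sqrt C\<^sub>2 * (l\<^sub>f + l\<^sub>g * l\<^sub>A)"
  have T_pos: "0 < T" using pos T by linarith
  have D: "0 < D" and B: "0 \<le> B" by (auto simp: D_def B_def)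
  have c: "0 < c" unfolding c_def using C\<^sub>1_pos C\<^sub>2_pos L\<^sub>h_pos \<theta>_pos \<kappa>_pos by (intro add_pos_pos) auto
  have Q: "0 < Q"
    unfolding Q_def using L\<^sub>f_nonneg l\<^sub>g_nonneg L\<^sub>h_pos \<alpha> pos by (intro add_nonneg_pos add_nonneg_nonneg) auto
  have ac: "0 < \<alpha> * c + \<sigma> / 2" using \<alpha> c pos by (intro add_pos_pos) auto
  have gap: "0 < gap" unfolding gap_def using \<alpha> by simp
  \<comment> \<open>Each entry of these two minima secures one hypothesis of
    \<open>step_accepted\<close>, with 1/T in place of the larger 1/t. The entry
    \<open>\<tau>'\<close> ties \<tau> to the value in the assumption on \<alpha>, and
    \<open>gap\<close> is positive by the other lower bound on \<alpha>.\<close>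
  define \<eta>s where "\<eta>s = min 1 (min (\<theta> / D) (1 / T / Q))"
  define \<tau>s where "\<tau>s = min \<tau>' (min (1 / C\<^sub>2) (min (\<kappa> / sqrt C\<^sub>2) (min (C\<^sub>1 / c) (gap / (\<alpha> * c + \<sigma> / 2)))))"
  have \<eta>s: "0 < \<eta>s" using \<theta>_pos D T_pos Q by (simp add: \<eta>s_def)
  have \<tau>s: "0 < \<tau>s" using pos C\<^sub>1_pos C\<^sub>2_pos \<kappa>_pos c gap ac by (simp add: \<tau>s_def)
  have \<eta>sD: "\<eta> * D \<le> \<theta>" "\<eta> * Q \<le> 1 / T" "\<eta> \<le> 1" if "\<eta> \<le> \<eta>s" for \<eta>
    using that D Q unfolding \<eta>s_def by (auto simp: pos_le_divide_eq simp del: divide_divide_eq_left)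
  have \<tau>sD: "\<tau> \<le> \<tau>'" "\<tau> * C\<^sub>2 \<le> 1" "\<tau> * sqrt C\<^sub>2 \<le> \<kappa>" "\<tau> * c \<le> C\<^sub>1" "\<tau> * (\<alpha> * c + \<sigma> / 2) \<le> gap" if "\<tau> \<le> \<tau>s" for \<tau>
    using that c C\<^sub>2_pos ac unfolding \<tau>s_def by (auto simp: pos_le_divide_eq)
  obtain n1 where n1: "\<gamma> ^ n1 < \<eta>s / \<eta>\<^sub>0" using real_arch_pow_inv[of "\<eta>s / \<eta>\<^sub>0" \<gamma>] \<eta>s pos \<gamma> by auto
  obtain n2 where n2: "(\<gamma> / 2) ^ n2 < \<tau>s / \<tau>\<^sub>0" using real_arch_pow_inv[of "\<tau>s / \<tau>\<^sub>0" "\<gamma> / 2"] \<tau>s pos \<gamma> by auto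
  \<comment> \<open>After \<open>n\<close> reductions both step sizes are below their thresholds;
    \<open>n\<close> is the same for all iterates, so \<open>\<eta>l\<close> and
    \<open>\<tau>l\<close> are uniform lower bounds on accepted step sizes.\<close>
  define n where "n = max n1 n2"
  define \<eta>l where "\<eta>l = \<gamma> ^ n * \<eta>\<^sub>0"
  define \<tau>l where "\<tau>l = (\<gamma> / 2) ^ n * \<tau>\<^sub>0"
  have l_pos: "0 < \<eta>l" "0 < \<tau>l" using \<gamma> pos by (simp_all add: \<eta>l_def \<tau>l_def)
  have "\<gamma> ^ n \<le> \<gamma> ^ n1" "(\<gamma> / 2) ^ n \<le> (\<gamma> / 2) ^ n2"
    using \<gamma> by (auto simp: n_def intro!: power_decreasing)
  then have l_small: "\<eta>l \<le> \<eta>s" "\<tau>l \<le> \<tau>s"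
    using n1 n2 pos unfolding \<eta>l_def \<tau>l_def by (auto simp: pos_less_divide_eq intro: order_trans[OF mult_right_mono less_imp_le])
  \<comment> \<open>The first entry lets the test pay for \<delta> |h y|. The second lets the
    second-order term of \<open>h_step_rev\<close> use at most half of the \<sigma>/2 term in |d|^2;
    the other half is what \<open>e\<close> draws on.\<close>
  define \<delta> where "\<delta> = \<sigma> / 2 * min (\<tau>l\<^sup>2) (1 / (2 * L\<^sub>h))"
  define e where "e = min (\<sigma> / 4 * \<eta>l\<^sup>2) (\<eta>l / (2 * T))"
  \<comment> \<open>The 1 serves the case of a large |v|, the other summand that of a large gradient
    residual (|d| + \<open>l\<^sub>A\<close> |v|)/t.\<close>
  define q where "q = 1 + 2 * (1 + l\<^sub>A\<^sup>2) / T\<^sub>0\<^sup>2"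
  \<comment> \<open>The first summand bounds the inexactness error in the acceptance test, the
    second the one incurred in passing from \<open>h\<close> at the trial base point back to |h
    x|.\<close>
  define E where "E = \<eta>\<^sub>0 * (\<alpha> + l\<^sub>g + B) + \<delta> * \<eta>\<^sub>0"
  have \<delta>: "0 < \<delta>" using pos l_pos L\<^sub>h_pos by (simp add: \<delta>_def)
  have e: "0 < e" using pos l_pos T_pos by (simp add: e_def)
  have q: "0 < q" unfolding q_def by (intro add_pos_nonneg) auto
  show thesis
  proof (rule that[of "q / e + 1 / \<delta>" E])
    show "0 < q / e + 1 / \<delta>" using q e \<delta> by (intro add_pos_pos) auto
    show "0 \<le> E" unfolding E_def using pos \<alpha> l\<^sub>g_nonneg B \<delta> by (intro add_nonneg_nonneg mult_nonneg_nonneg) auto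
  next
    fix t \<Delta> \<rho> :: real and x x' :: "real^'n"
    assume t: "t \<in> {T\<^sub>0..T}" and \<Delta>: "\<Delta> \<in> {0..\<Delta>\<^sub>0}" and \<rho>: "0 \<le> \<rho>" and hx: "norm (h x) \<le> \<theta> / \<kappa>"
      and step: "fsipl_step f g A h M \<theta> \<kappa> l\<^sub>g \<gamma> \<alpha> \<eta>\<^sub>0 \<tau>\<^sub>0 \<sigma> t \<Delta> \<rho> x x'"
    from step obtain lam \<mu> where grad: "norm (gradient (subproblem f g A h t x) (lam, \<mu>)) \<le> \<Delta>"
      and step': "let d = - t *\<^sub>R (gradient f x + transpose (J x) *v lam + transpose (K x) *v \<mu>);
             v = prox g t (A x + t *\<^sub>R \<mu>) - A x
         in backtrack \<gamma>
              (\<lambda>\<eta> \<tau> z. correction_step h M \<theta> \<kappa> \<tau> (x + \<eta> *\<^sub>R d) z)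
              (\<lambda>\<eta> \<tau> z. norm (h z) \<le> \<theta> / \<kappa> \<and>
                 merit f g A h \<alpha> z \<le> merit f g A h \<alpha> x
                   - \<sigma> / 2 * (\<eta>\<^sup>2 * (norm d)\<^sup>2 + \<tau>\<^sup>2 * norm (h (x + \<eta> *\<^sub>R d)))
                   - \<eta> / (2 * t) * (norm v)\<^sup>2
                   + \<eta> * (\<alpha> + l\<^sub>g + norm lam + norm \<mu>) * \<Delta> + \<rho>)
              \<eta>\<^sub>0 \<tau>\<^sub>0 x'"
      unfolding fsipl_step_def by blast
    have t_pos: "0 < t" using t pos by auto
    interpret fsipl_direction f g A h M \<kappa> \<theta> C\<^sub>1 C\<^sub>2 L\<^sub>h L\<^sub>f L\<^sub>A l\<^sub>f l\<^sub>g l\<^sub>A x lam \<mu> t \<Delta>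
      using in_tube_if_small[OF hx] t_pos grad by unfold_locales
    let ?nd = "norm d" and ?nv = "norm v"
    define ok where "ok = (\<lambda>\<eta> \<tau> z. norm (h z) \<le> \<theta> / \<kappa> \<and>
        merit f g A h \<alpha> z \<le> merit f g A h \<alpha> x
          - \<sigma> / 2 * (\<eta>\<^sup>2 * ?nd\<^sup>2 + \<tau>\<^sup>2 * norm (h (x + \<eta> *\<^sub>R d)))
          - \<eta> / (2 * t) * ?nv\<^sup>2 + \<eta> * (\<alpha> + l\<^sub>g + norm lam + norm \<mu>) * \<Delta> + \<rho>)"
    have bt: "backtrack \<gamma> (\<lambda>\<eta> \<tau> z. correction_step h M \<theta> \<kappa> \<tau> (x + \<eta> *\<^sub>R d) z) ok \<eta>\<^sub>0 \<tau>\<^sub>0 x'"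
      using step' unfolding Let_def ok_def d_def[symmetric] v_def[symmetric] .
    have dir: "?nd + ?nv \<le> direction_bound T \<Delta>\<^sub>0" and mult: "norm lam + norm \<mu> \<le> multiplier_bound T\<^sub>0 T \<Delta>\<^sub>0"
      using direction_le multipliers_le t \<Delta> pos by auto
    have ok_l: "ok \<eta>l \<tau>l z" if z: "correction_step h M \<theta> \<kappa> \<tau>l (x + \<eta>l *\<^sub>R d) z" for z
    proof -
      have "?nd \<le> D" using dir norm_ge_zero[of v] unfolding D_def by linarith
      then have "\<eta>l * ?nd \<le> \<theta>"
        using \<eta>sD(1)[OF l_small(1)] mult_left_mono[of ?nd D \<eta>l] l_pos by linarith
      moreover have "\<eta>l * Q \<le> 1 / t"
        using \<eta>sD(2)[OF l_small(1)] t t_pos by (auto intro: order_trans simp: frac_le)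
      moreover have "\<tau>l\<^sup>2 \<le> \<tau>'\<^sup>2" using \<tau>sD(1)[OF l_small(2)] l_pos by (intro power_mono) auto
      then have "\<kappa> * (l\<^sub>f + l\<^sub>g * l\<^sub>A) + \<sigma> * \<tau>l\<^sup>2 / 2 \<le> \<alpha>"
        using \<alpha>(3) mult_left_mono[of "\<tau>l\<^sup>2" "\<tau>'\<^sup>2" \<sigma>] pos by linarith
      ultimately show ?thesis
        unfolding ok_def
        using step_accepted[OF l_pos(1) \<eta>sD(3)[OF l_small(1)] _ _ l_pos(2) \<tau>sD(2,3)[OF l_small(2)] c_def
            \<tau>sD(4)[OF l_small(2)] _ \<tau>sD(5)[OF l_small(2), unfolded gap_def] _ \<rho> z] \<alpha>(1)
        unfolding Q_def by simp
    qed
    have "\<exists>j\<le>n. correction_step h M \<theta> \<kappa> ((\<gamma> / 2) ^ j * \<tau>\<^sub>0) (x + (\<gamma> ^ j * \<eta>\<^sub>0) *\<^sub>R d) x'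
        \<and> ok (\<gamma> ^ j * \<eta>\<^sub>0) ((\<gamma> / 2) ^ j * \<tau>\<^sub>0) x'"
      by (rule backtrack_bounded[OF bt ok_l[unfolded \<eta>l_def \<tau>l_def], where i = 0]) simp_all
    then obtain j where j: "j \<le> n" and ok: "ok (\<gamma> ^ j * \<eta>\<^sub>0) ((\<gamma> / 2) ^ j * \<tau>\<^sub>0) x'"
      by blast
    define \<eta> where "\<eta> = \<gamma> ^ j * \<eta>\<^sub>0"
    define \<tau> where "\<tau> = (\<gamma> / 2) ^ j * \<tau>\<^sub>0"
    have \<eta>: "\<eta>l \<le> \<eta>" "\<eta> \<le> \<eta>\<^sub>0"
      unfolding \<eta>_def \<eta>l_def using j \<gamma> pos by (auto intro: power_decreasing power_le_one)
    have \<tau>: "\<tau>l \<le> \<tau>"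
      unfolding \<tau>_def \<tau>l_def using j \<gamma> pos by (auto intro: power_decreasing)
    let ?hy = "norm (h (x + \<eta> *\<^sub>R d))" and ?h = "norm (h x)"
    define P where "P = merit f g A h \<alpha> x - merit f g A h \<alpha> x' + E * \<Delta> + \<rho>"
    have descent: "\<sigma> / 2 * (\<eta>\<^sup>2 * ?nd\<^sup>2) + \<sigma> / 2 * (\<tau>\<^sup>2 * ?hy) + \<eta> / (2 * t) * ?nv\<^sup>2
        \<le> merit f g A h \<alpha> x - merit f g A h \<alpha> x' + \<eta> * (\<alpha> + l\<^sub>g + norm lam + norm \<mu>) * \<Delta> + \<rho>"
      using ok unfolding ok_def \<eta>_def[symmetric] \<tau>_def[symmetric] by (simp add: distrib_left)
    have err: "\<eta> * (\<alpha> + l\<^sub>g + norm lam + norm \<mu>) * \<Delta> \<le> \<eta>\<^sub>0 * (\<alpha> + l\<^sub>g + B) * \<Delta>"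
    proof (intro mult_right_mono mult_mono)
      show "\<alpha> + l\<^sub>g + norm lam + norm \<mu> \<le> \<alpha> + l\<^sub>g + B" using mult unfolding B_def by linarith
    qed (use \<eta> pos \<alpha> l\<^sub>g_nonneg \<Delta> in auto)
    have hxy: "\<delta> * ?h \<le> \<sigma> / 2 * (\<tau>\<^sup>2 * ?hy) + \<delta> * \<eta>\<^sub>0 * \<Delta> + \<sigma> / 4 * (\<eta>\<^sup>2 * ?nd\<^sup>2)"
    proof -
      have "\<delta> * ?h \<le> \<delta> * (?hy + \<eta> * \<Delta> + L\<^sub>h * (\<eta>\<^sup>2 * ?nd\<^sup>2))"
        using h_step_rev[of \<eta>] \<delta> \<eta> l_pos by (intro mult_left_mono) auto
      moreover have "\<delta> * ?hy \<le> \<sigma> / 2 * \<tau>\<^sup>2 * ?hy"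
      proof (rule mult_right_mono)
        have "\<tau>l\<^sup>2 \<le> \<tau>\<^sup>2" using \<tau> l_pos by (intro power_mono) auto
        then show "\<delta> \<le> \<sigma> / 2 * \<tau>\<^sup>2" unfolding \<delta>_def using pos by (intro mult_left_mono) auto
      qed simp
      moreover have "\<delta> * (\<eta> * \<Delta>) \<le> \<delta> * (\<eta>\<^sub>0 * \<Delta>)"
        using \<delta> \<eta> \<Delta> by (intro mult_left_mono mult_right_mono) auto
      moreover have "\<delta> * L\<^sub>h * (\<eta>\<^sup>2 * ?nd\<^sup>2) \<le> \<sigma> / 4 * (\<eta>\<^sup>2 * ?nd\<^sup>2)"
      proof (rule mult_right_mono)
        have "\<delta> \<le> \<sigma> / 2 * (1 / (2 * L\<^sub>h))" unfolding \<delta>_def using pos by (intro mult_left_mono) auto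
        then show "\<delta> * L\<^sub>h \<le> \<sigma> / 4" using L\<^sub>h_pos by (simp add: field_simps)
      qed simp
      ultimately show ?thesis by (simp add: algebra_simps)
    qed
    have nd: "e * ?nd\<^sup>2 \<le> \<sigma> / 4 * (\<eta>\<^sup>2 * ?nd\<^sup>2)"
    proof -
      have "\<eta>l\<^sup>2 \<le> \<eta>\<^sup>2" using \<eta> l_pos by (intro power_mono) auto
      then have "e \<le> \<sigma> / 4 * \<eta>\<^sup>2"
        unfolding e_def using mult_left_mono[of "\<eta>l\<^sup>2" "\<eta>\<^sup>2" "\<sigma> / 4"] pos by linarith
      then show ?thesis using mult_right_mono[of e "\<sigma> / 4 * \<eta>\<^sup>2" "?nd\<^sup>2"] by (simp add: mult.assoc)
    qed
    have nv: "e * ?nv\<^sup>2 \<le> \<eta> / (2 * t) * ?nv\<^sup>2"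
    proof (rule mult_right_mono)
      have "\<eta>l / (2 * T) \<le> \<eta> / (2 * t)" using \<eta> t t_pos l_pos by (intro frac_le) auto
      then show "e \<le> \<eta> / (2 * t)" unfolding e_def by linarith
    qed simp
    have sum_le: "e * (?nd\<^sup>2 + ?nv\<^sup>2) + \<delta> * ?h \<le> P"
      using descent err hxy nd nv unfolding P_def E_def by (simp add: algebra_simps)
    have "1 \<le> (q / e + 1 / \<delta>) * P * (1 / \<epsilon>\<^sup>2 + 1 / \<epsilon>)"
      if \<epsilon>: "0 < \<epsilon>" and ns: "\<not> eps_stationary f g A h \<epsilon> x" for \<epsilon>
    proof -
      have le_e: "e * (?nd\<^sup>2 + ?nv\<^sup>2) \<le> P" using sum_le mult_nonneg_nonneg[OF less_imp_le[OF \<delta>] norm_ge_zero[of "h x"]] by linarith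
      have le_\<delta>: "\<delta> * ?h \<le> P" using sum_le mult_nonneg_nonneg[OF less_imp_le[OF e] sum_power2_ge_zero[of ?nd ?nv]] by linarith
      have P: "0 \<le> P" using le_\<delta> \<delta> by (meson less_imp_le mult_nonneg_nonneg norm_ge_zero order_trans)
      \<comment> \<open>All four products are nonnegative, and in each of the two cases below one of
        them alone is at least 1.\<close>
      have expand: "(q / e + 1 / \<delta>) * P * (1 / \<epsilon>\<^sup>2 + 1 / \<epsilon>)
          = q / e * P * (1 / \<epsilon>\<^sup>2) + 1 / \<delta> * P * (1 / \<epsilon>) + (q / e * P * (1 / \<epsilon>) + 1 / \<delta> * P * (1 / \<epsilon>\<^sup>2))"
        by (simp add: algebra_simps)
      have nonneg: "0 \<le> q / e * P * (1 / \<epsilon>\<^sup>2)" "0 \<le> 1 / \<delta> * P * (1 / \<epsilon>)" "0 \<le> q / e * P * (1 / \<epsilon>)"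
          "0 \<le> 1 / \<delta> * P * (1 / \<epsilon>\<^sup>2)"
        using q e \<delta> P \<epsilon> by (auto intro!: mult_nonneg_nonneg divide_nonneg_nonneg)
      consider "\<epsilon>\<^sup>2 \<le> q * (?nd\<^sup>2 + ?nv\<^sup>2)" | "\<epsilon> \<le> ?h"
      proof -
        have "\<epsilon>\<^sup>2 \<le> q * (?nd\<^sup>2 + ?nv\<^sup>2)" if "\<epsilon> \<le> (?nd + l\<^sub>A * ?nv) / t"
        proof -
          have "(?nd + l\<^sub>A * ?nv) / t \<le> (?nd + l\<^sub>A * ?nv) / T\<^sub>0"
            using t pos l\<^sub>A_pos by (intro divide_left_mono) auto
          then have "\<epsilon>\<^sup>2 \<le> ((?nd + l\<^sub>A * ?nv) / T\<^sub>0)\<^sup>2" using that \<epsilon> by (intro power_mono) auto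
          also have "\<dots> = (?nd + l\<^sub>A * ?nv)\<^sup>2 / T\<^sub>0\<^sup>2" by (simp add: power_divide)
          also have "(?nd + l\<^sub>A * ?nv)\<^sup>2 \<le> 2 * (?nd\<^sup>2 + l\<^sub>A\<^sup>2 * ?nv\<^sup>2)"
            using sum_squares_bound[of ?nd "l\<^sub>A * ?nv"] by (simp add: power2_sum power_mult_distrib)
          also have "\<dots> \<le> 2 * (1 + l\<^sub>A\<^sup>2) * (?nd\<^sup>2 + ?nv\<^sup>2)" by (simp add: algebra_simps)
          finally have "\<epsilon>\<^sup>2 \<le> 2 * (1 + l\<^sub>A\<^sup>2) / T\<^sub>0\<^sup>2 * (?nd\<^sup>2 + ?nv\<^sup>2)"
            using pos by (simp add: divide_right_mono)
          then show ?thesis unfolding q_def distrib_right[of 1] by (simp add: add_increasing)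
        qed
        moreover have "\<epsilon>\<^sup>2 \<le> q * (?nd\<^sup>2 + ?nv\<^sup>2)" if "\<epsilon> \<le> ?nv"
        proof -
          have "\<epsilon>\<^sup>2 \<le> ?nv\<^sup>2" using that \<epsilon> by (intro power_mono) auto
          also have "\<dots> \<le> 1 * (?nd\<^sup>2 + ?nv\<^sup>2)" by simp
          also have "\<dots> \<le> q * (?nd\<^sup>2 + ?nv\<^sup>2)" by (intro mult_right_mono) (auto simp: q_def)
          finally show ?thesis .
        qed
        ultimately show thesis using that not_eps_stationary[OF ns] by blast
      qed
      then show ?thesis
      proof cases
        case 1
        also have "q * (?nd\<^sup>2 + ?nv\<^sup>2) \<le> q / e * P"
          using mult_left_mono[OF le_e, of "q / e"] q e by simp
        finally have "1 \<le> q / e * P * (1 / \<epsilon>\<^sup>2)"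
          using \<epsilon> by (simp only: times_divide_eq_right pos_le_divide_eq zero_less_power mult_1_left mult_1_right)
        then show ?thesis unfolding expand using nonneg by linarith
      next
        case 2
        also have "?h \<le> 1 / \<delta> * P" using le_\<delta> \<delta> by (simp add: pos_le_divide_eq mult.commute)
        finally have "1 \<le> 1 / \<delta> * P * (1 / \<epsilon>)"
          using \<epsilon> by (simp only: times_divide_eq_right pos_le_divide_eq mult_1_left mult_1_right)
        then show ?thesis unfolding expand using nonneg by linarith
      qed
    qed
    then show "norm (h x') \<le> \<theta> / \<kappa> \<and> (\<forall>\<epsilon>>0. \<not> eps_stationary f g A h \<epsilon> x \<longrightarrow>
        1 \<le> (q / e + 1 / \<delta>) * (merit f g A h \<alpha> x - merit f g A h \<alpha> x' + E * \<Delta> + \<rho>) * (1 / \<epsilon>\<^sup>2 + 1 / \<epsilon>))"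
      using ok unfolding ok_def P_def by blast
  qed
qed

end

section \<open>Summation over the iterations and the complexity bound\<close>

theorem theorem5:
  fixes f :: "real^'n \<Rightarrow> real" and g :: "real^'p \<Rightarrow> real"
    and A :: "real^'n \<Rightarrow> real^'p" and h :: "real^'n \<Rightarrow> real^'m"
    and M :: "(real^'n) set"
    and \<kappa> \<theta> C\<^sub>1 C\<^sub>2 L\<^sub>h L\<^sub>f L\<^sub>A l\<^sub>f l\<^sub>g l\<^sub>A :: real
    and \<gamma> \<alpha> t_min t_max \<Delta>_max \<eta>_max \<tau>_max \<sigma> M\<^sub>1 M\<^sub>2 \<tau>_hat :: real
    and t \<Delta> \<rho> :: "nat \<Rightarrow> real" and x :: "nat \<Rightarrow> real^'n"
  assumes "compact M" and "embedded_submanifold M"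
    and "C1_on UNIV f" and "C1_on UNIV A" and "C1_on UNIV h"
    and "convex_on UNIV g" and "closed (epigraph UNIV g)"
    and "M = {z. h z = 0}"
    and "\<kappa> > 0" and "\<And>z. infdist z M \<le> \<kappa> * norm (h z)"
    and "L\<^sub>h > 0"
    and "\<And>y z. spectral_norm (jacobian h (at y) - jacobian h (at z)) \<le> L\<^sub>h * dist y z"
    and "\<theta> > 0" and "0 < C\<^sub>1" and "C\<^sub>1 \<le> C\<^sub>2"
    and "\<And>z. z \<in> tube M (2 * \<theta>) \<Longrightarrow>
           eigenvalues (jacobian h (at z) ** transpose (jacobian h (at z))) \<subseteq> {C\<^sub>1..C\<^sub>2}"
    and "L\<^sub>f-lipschitz_on UNIV (gradient f)"
    and "l\<^sub>g-lipschitz_on UNIV g"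
    and "\<And>y z. spectral_norm (jacobian A (at y) - jacobian A (at z)) \<le> L\<^sub>A * dist y z"
    and "l\<^sub>f > 0" and "\<And>z. z \<in> tube M (2 * \<theta>) \<Longrightarrow> norm (gradient f z) \<le> l\<^sub>f"
    and "l\<^sub>A > 0" and "\<And>z. z \<in> tube M (2 * \<theta>) \<Longrightarrow> spectral_norm (jacobian A (at z)) \<le> l\<^sub>A"
    and "\<gamma> \<in> {0<..<1}" and "\<alpha> > 0" and "0 < t_min" and "t_min \<le> t_max"
    and "\<Delta>_max > 0" and "\<eta>_max > 0" and "\<tau>_max > 0" and "\<sigma> > 0"
    and "\<And>k. \<rho> k \<ge> 0" and "summable \<rho>"
    and "M\<^sub>1 = sqrt C\<^sub>2 * (l\<^sub>f + l\<^sub>g * l\<^sub>A)" and "M\<^sub>2 = \<kappa> * (l\<^sub>f + l\<^sub>g * l\<^sub>A)"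
    and "\<tau>_hat = min (2 * \<kappa> * C\<^sub>1 / (\<theta> * L\<^sub>h * C\<^sub>2)) (1 / C\<^sub>2)"
    and "\<alpha> > max (M\<^sub>1 / C\<^sub>1) (M\<^sub>2 + \<sigma> * \<tau>_hat\<^sup>2 / 2)"
    and "x 0 \<in> M"
    and "\<And>k. t k \<in> {t_min..t_max}" and "\<And>k. \<Delta> k \<in> {0..\<Delta>_max}" and "summable \<Delta>"
    and "\<And>k. fsipl_step f g A h M \<theta> \<kappa> l\<^sub>g \<gamma> \<alpha> \<eta>_max \<tau>_max \<sigma> (t k) (\<Delta> k) (\<rho> k)
               (x k) (x (Suc k))"
  shows "\<exists>U>0. \<exists>V>0. \<forall>\<epsilon>>0.
           (\<exists>k. eps_stationary f g A h \<epsilon> (x k)) \<and>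
           real (LEAST k. eps_stationary f g A h \<epsilon> (x k)) \<le> max (U * V\<^sup>2 / \<epsilon>\<^sup>2) (U * V / \<epsilon>)"

proof -
  have M_eq: "M = {z. h z = 0}" by fact
  interpret fsipl_problem f g A h M \<kappa> \<theta> C\<^sub>1 C\<^sub>2 L\<^sub>h L\<^sub>f L\<^sub>A l\<^sub>f l\<^sub>g l\<^sub>A
    by unfold_locales (fact assms | use \<open>x 0 \<in> M\<close> in blast)+
  have \<tau>_hat: "0 < \<tau>_hat"
    unfolding \<open>\<tau>_hat = _\<close> using \<kappa>_pos C\<^sub>1_pos C\<^sub>2_pos L\<^sub>h_pos \<theta>_pos by simp
  have \<alpha>1: "sqrt C\<^sub>2 * (l\<^sub>f + l\<^sub>g * l\<^sub>A) < \<alpha> * C\<^sub>1"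
    using \<open>\<alpha> > max (M\<^sub>1 / C\<^sub>1) _\<close> C\<^sub>1_pos unfolding \<open>M\<^sub>1 = _\<close> by (simp add: pos_divide_less_eq)
  have \<alpha>2: "\<kappa> * (l\<^sub>f + l\<^sub>g * l\<^sub>A) + \<sigma> * \<tau>_hat\<^sup>2 / 2 \<le> \<alpha>"
    using \<open>\<alpha> > max (M\<^sub>1 / C\<^sub>1) _\<close> unfolding \<open>M\<^sub>2 = _\<close> by simp
  have \<gamma>: "0 < \<gamma>" "\<gamma> < 1" using \<open>\<gamma> \<in> _\<close> by simp_all
  let ?\<Phi> = "merit f g A h \<alpha>" and ?stat = "\<lambda>\<epsilon> k. eps_stationary f g A h \<epsilon> (x k)"
  obtain C E where C: "0 < C" and E: "0 \<le> E"
    and progress: "\<And>t \<Delta> \<rho> x x'. \<lbrakk>t \<in> {t_min..t_max}; \<Delta> \<in> {0..\<Delta>_max}; 0 \<le> \<rho>; norm (h x) \<le> \<theta> / \<kappa>;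
        fsipl_step f g A h M \<theta> \<kappa> l\<^sub>g \<gamma> \<alpha> \<eta>_max \<tau>_max \<sigma> t \<Delta> \<rho> x x'\<rbrakk> \<Longrightarrow>
      norm (h x') \<le> \<theta> / \<kappa> \<and>
      (\<forall>\<epsilon>>0. \<not> eps_stationary f g A h \<epsilon> x \<longrightarrow>
        1 \<le> C * (?\<Phi> x - ?\<Phi> x' + E * \<Delta> + \<rho>) * (1 / \<epsilon>\<^sup>2 + 1 / \<epsilon>))"
    using fsipl_step_progress[OF \<gamma> \<open>\<eta>_max > 0\<close> \<open>\<tau>_max > 0\<close> \<open>\<sigma> > 0\<close> \<open>0 < t_min\<close> \<tau>_hat \<open>t_min \<le> t_max\<close>
        \<open>\<alpha> > 0\<close> \<alpha>1 \<alpha>2, of \<Delta>_max] by blast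
  note step = progress[OF \<open>\<And>k. t k \<in> _\<close> \<open>\<And>k. \<Delta> k \<in> _\<close> \<open>\<And>k. 0 \<le> \<rho> k\<close> _
      \<open>\<And>k. fsipl_step _ _ _ _ _ _ _ _ _ _ _ _ _ _ _ _ (x k) _\<close>]
  \<comment> \<open>The start has h = 0, and the acceptance test preserves the bound; so all
    iterates stay in the tube where the merit function is bounded below.\<close>
  have hx: "norm (h (x k)) \<le> \<theta> / \<kappa>" for k
  proof (induction k)
    case 0
    then show ?case using \<open>x 0 \<in> M\<close> \<theta>_pos \<kappa>_pos unfolding M_eq by simp
  qed (use step in blast)
  obtain b where b: "\<And>z. z \<in> tube M (2 * \<theta>) \<Longrightarrow> b \<le> ?\<Phi> z"
    using merit_bounded_below \<open>\<alpha> > 0\<close> by (metis less_imp_le)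
  \<comment> \<open>Up to the factor \<open>C\<close> this is the total available decrease plus all
    summable errors; the absolute value gives nonnegativity at once.\<close>
  define S where "S = C * \<bar>?\<Phi> (x 0) - b + E * (\<Sum>k. \<Delta> k) + (\<Sum>k. \<rho> k)\<bar>"
  have S: "0 \<le> S" unfolding S_def using C by simp
  \<comment> \<open>The witnesses are U = 2S + 1 and V = 1; the added 1 keeps \<open>U\<close>
    positive when \<open>S\<close> is 0. Each of the first \<open>N\<close> iterates contributes at
    least 1 to a telescoping sum.\<close>
  have count: "real N \<le> max ((2 * S + 1) * 1\<^sup>2 / \<epsilon>\<^sup>2) ((2 * S + 1) * 1 / \<epsilon>)"
    if \<epsilon>: "0 < \<epsilon>" and ns: "\<And>k. k < N \<Longrightarrow> \<not> ?stat \<epsilon> k" for \<epsilon> N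
  proof -
    let ?R = "1 / \<epsilon>\<^sup>2 + 1 / \<epsilon>"
    have R: "0 \<le> ?R" using \<epsilon> by simp
    have "real N = (\<Sum>k<N. 1)" by simp
    also have "\<dots> \<le> (\<Sum>k<N. C * (?\<Phi> (x k) - ?\<Phi> (x (Suc k)) + E * \<Delta> k + \<rho> k) * ?R)"
      using step[OF hx] \<epsilon> ns by (intro sum_mono) blast
    also have "\<dots> = C * (?\<Phi> (x 0) - ?\<Phi> (x N) + E * (\<Sum>k<N. \<Delta> k) + (\<Sum>k<N. \<rho> k)) * ?R"
      unfolding sum_distrib_right[symmetric] sum_distrib_left[symmetric] sum.distrib
        sum_lessThan_telescope'[of "\<lambda>k. ?\<Phi> (x k)"] ..
    also have "\<dots> \<le> S * ?R"
    proof (rule mult_right_mono[OF _ R])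
      have "(\<Sum>k<N. \<rho> k) \<le> (\<Sum>k. \<rho> k)"
        using \<open>summable \<rho>\<close> \<open>\<And>k. 0 \<le> \<rho> k\<close> by (intro sum_le_suminf) auto
      moreover have "(\<Sum>k<N. \<Delta> k) \<le> (\<Sum>k. \<Delta> k)"
        using \<open>summable \<Delta>\<close> \<open>\<And>k. \<Delta> k \<in> _\<close> by (intro sum_le_suminf) auto
      then have "E * (\<Sum>k<N. \<Delta> k) \<le> E * (\<Sum>k. \<Delta> k)" using E by (rule mult_left_mono)
      moreover have "b \<le> ?\<Phi> (x N)" by (intro b tube_mono in_tube_if_small hx)
      ultimately show "C * (?\<Phi> (x 0) - ?\<Phi> (x N) + E * (\<Sum>k<N. \<Delta> k) + (\<Sum>k<N. \<rho> k)) \<le> S"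
        unfolding S_def using C by (intro mult_left_mono) auto
    qed
    finally have "real N \<le> max (2 * S / \<epsilon>\<^sup>2) (2 * S / \<epsilon>)"
      by (rule nat_le_max_of_reciprocal_bound[OF S \<epsilon>])
    also have "\<dots> \<le> max ((2 * S + 1) * 1\<^sup>2 / \<epsilon>\<^sup>2) ((2 * S + 1) * 1 / \<epsilon>)"
      using \<epsilon> by (intro max.mono divide_right_mono) auto
    finally show ?thesis .
  qed
  have "(\<exists>k. ?stat \<epsilon> k) \<and> real (LEAST k. ?stat \<epsilon> k) \<le> max ((2 * S + 1) * 1\<^sup>2 / \<epsilon>\<^sup>2) ((2 * S + 1) * 1 / \<epsilon>)"
    if \<epsilon>: "0 < \<epsilon>" for \<epsilon>
  proof
    show "\<exists>k. ?stat \<epsilon> k"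
    proof (rule ccontr)
      \<comment> \<open>Without a stationary iterate \<open>count\<close> would bound every natural
        number.\<close>
      assume "\<nexists>k. ?stat \<epsilon> k"
      then have "real N \<le> max ((2 * S + 1) * 1\<^sup>2 / \<epsilon>\<^sup>2) ((2 * S + 1) * 1 / \<epsilon>)" for N
        using count[OF \<epsilon>] by blast
      then show False using reals_Archimedean2 not_le by blast
    qed
    show "real (LEAST k. ?stat \<epsilon> k) \<le> max ((2 * S + 1) * 1\<^sup>2 / \<epsilon>\<^sup>2) ((2 * S + 1) * 1 / \<epsilon>)"
      \<comment> \<open>Take N to be the least stationary index itself: all smaller indices are not
        stationary.\<close>
      by (rule count[OF \<epsilon>]) (rule not_less_Least)
  qed
  moreover have "0 < 2 * S + 1" using S by simp
  ultimately show ?thesis using zero_less_one by blast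
qed

end
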